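(* Let $q\ge 2$ be an integer, let $a>0$ be real and let $\mathbf{x}_0=(x_1,\dots,x_q)\in\mathbb{R}_{>0}^q$. Let $(\mathbf{X}_n)_{n\ge0}$ be the Pólya urn with $q$ colours, replacement parameter $a$ and initial state $\mathbf{X}_0=\mathbf{x}_0$, and let $Y_{n,i}$ be the number of draws of colour $i$ among the first $n$ draws. Let $i\in\{1,\dots,q\}$ and let $W_i\sim\mathrm{Beta}\bigl(x_i/a,(|\mathbf{x}_0|-x_i)/a\bigr)$. Then there exist constants $0<c\le C<\infty$, which may depend on $q$, $a$ and $\mathbf{x}_0$ but not on $n$, such that for all integers $n\ge1$, $$\frac{c}{n}\le d_{\mathrm{L}}\Bigl(\frac{X_{n,i}}{|\mathbf{X}_n|},W_i\Bigr)\le \frac{C}{n}\qquad\text{and}\qquad \frac{c}{n}\le d_{\mathrm{L}}\Bigl(\frac{Y_{n,i}}{n},W_i\Bigr)\le \frac{C}{n}.$$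
   Context: Norm: for $\mathbf{x}\in\mathbb{R}^q$, $|\mathbf{x}|:=\sum_{i=1}^q|x_i|$. Pólya urn: given $q\ge2$, $a>0$ and $\mathbf{x}_0\in\mathbb{R}_{>0}^q$ (the entries need not be integers), the urn is the Markov chain $\mathbf{X}_n=(X_{n,1},\dots,X_{n,q})$, $n\ge0$, in $\mathbb{R}_{>0}^q$ with deterministic initial value $\mathbf{X}_0=\mathbf{x}_0$ and transition probabilities $$\mathbb{P}(\mathbf{X}_{n+1}=\mathbf{X}_n+a\mathbf{e}_i\mid\mathbf{X}_n)=\frac{X_{n,i}}{|\mathbf{X}_n|},\qquad i=1,\dots,q,$$ where $\mathbf{e}_1,\dots,\mathbf{e}_q$ are the standard unit vectors. Thus $|\mathbf{X}_n|=an+|\mathbf{x}_0|$ is deterministic. The vector $\mathbf{Y}_n=(Y_{n,1},\dots,Y_{n,q})$, where $Y_{n,i}$ is the number of steps among the first $n$ in which colour $i$ is drawn (i.e. $a\mathbf{e}_i$ is added), satisfies $\mathbf{X}_n=\mathbf{x}_0+a\mathbf{Y}_n$. Beta distribution: for $\alpha,\beta>0$, $\mathrm{Beta}(\alpha,\beta)$ has density $B(\alpha,\beta)^{-1}x^{\alpha-1}(1-x)^{\beta-1}$ on $0<x<1$, with $B(\alpha,\beta)=\Gamma(\alpha)\Gamma(\beta)/\Gamma(\alpha+\beta)$. Lévy distance: for real random variables $X,Y$ with distribution functions $F_X(x)=\mathbb{P}(X\le x)$ and $F_Y(x)=\mathbb{P}(Y\le x)$, $$d_{\mathrm{L}}(X,Y):=\inf\{\varepsilon>0: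 F_X(x-\varepsilon)-\varepsilon\le F_Y(x)\le F_X(x+\varepsilon)+\varepsilon\text{ for all }x\in\mathbb{R}\}.$$ *)

theory Defs
  imports "HOL-Probability.Probability"
begin

definition l1_norm :: "real ^ 'q \<Rightarrow> real" where
  "l1_norm x = (\<Sum>i\<in>UNIV. \<bar>x $ i\<bar>)"

(* The colours are the elements of the finite type 'q, and axis i 1 is the unit vector e_i.
   Started at a deterministic point, the chain almost surely visits only countably many states,
   so the Markov property together with the transition law can be stated by elementary
   conditioning on each history s 0, ..., s n of positive probability. *)
locale polya_urn = prob_space M
  for M :: "'w measure" +
  fixes a :: real and x0 :: "real ^ 'q" and X :: "nat \<Rightarrow> 'w \<Rightarrow> real ^ 'q"
  assumes measurable_state: "X n \<in> borel_measurable M"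
    and state_pos: "\<omega> \<in> space M \<Longrightarrow> 0 < X n \<omega> $ i"
    and initial: "\<omega> \<in> space M \<Longrightarrow> X 0 \<omega> = x0"
    and transition:
      "0 < \<P>(\<omega> in M. \<forall>k\<le>n. X k \<omega> = s k) \<Longrightarrow>
        \<P>(\<omega> in M. X (Suc n) \<omega> = X n \<omega> + a *\<^sub>R axis i 1 \<bar> \<forall>k\<le>n. X k \<omega> = s k)
          = s n $ i / l1_norm (s n)"

(* Colour i is drawn in step k + 1 iff that step adds a e_i. *)
definition draws :: "real \<Rightarrow> (nat \<Rightarrow> 'w \<Rightarrow> real ^ 'q) \<Rightarrow> nat \<Rightarrow> 'q \<Rightarrow> 'w \<Rightarrow> nat" where
  "draws a X n i \<omega> = card {k. k < n \<and> X (Suc k) \<omega> = X k \<omega> + a *\<^sub>R axis i 1}"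

definition beta_density :: "real \<Rightarrow> real \<Rightarrow> real \<Rightarrow> real" where
  "beta_density \<alpha> \<beta> x =
    (if 0 < x \<and> x < 1 then x powr (\<alpha> - 1) * (1 - x) powr (\<beta> - 1) / Beta \<alpha> \<beta> else 0)"

(* The random variables X and Y may live on different probability spaces M and N. *)
definition levy_dist ::
  "'w measure \<Rightarrow> ('w \<Rightarrow> real) \<Rightarrow> 'v measure \<Rightarrow> ('v \<Rightarrow> real) \<Rightarrow> real" where
  "levy_dist M X N Y =
    Inf {\<epsilon>. 0 < \<epsilon> \<and>
      (\<forall>x. cdf (distr M borel X) (x - \<epsilon>) - \<epsilon> \<le> cdf (distr N borel Y) x \<and>
           cdf (distr N borel Y) x \<le> cdf (distr M borel X) (x + \<epsilon>) + \<epsilon>)}"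

end

theory Submission
  imports Defs
begin

text \<open>
  With \<open>\<alpha> = x\<^sub>i / a\<close> and \<open>\<beta> = (\<bar>x\<^sub>0\<bar> - x\<^sub>i) / a\<close>, the number of draws of colour \<open>i\<close> is beta-binomial.
  Put \<open>z\<^sub>k = (\<Gamma>(k + \<alpha>) / \<Gamma>(k))\<^bsup>1/\<alpha>\<^esup>\<close>. The integral of \<open>w\<^bsup>\<alpha> - 1\<^esup>\<close> over \<open>[z\<^sub>k, z\<^sub>k\<^sub>+\<^sub>1]\<close> is exactly
  \<open>\<Gamma>(k + \<alpha>) / \<Gamma>(k + 1)\<close>, the \<open>\<alpha>\<close>-factor of the \<open>k\<close>-th beta-binomial weight, and log-convexity of \<open>\<Gamma>\<close> gives
  \<open>k - 1 \<le> z\<^sub>k \<le> k + \<alpha>\<close>. For \<open>k \<le> n / 2\<close> the other factors are smooth, so the \<open>k\<close>-th weight equals the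
  beta probability of \<open>[z\<^sub>k / n, z\<^sub>k\<^sub>+\<^sub>1 / n]\<close> up to a factor \<open>exp (O(1 / n))\<close>, even where the beta density is
  unbounded. Summing, and using the reflection \<open>w \<mapsto> 1 - w\<close> for \<open>k > n / 2\<close>, the two distribution functions
  agree up to \<open>O(1 / n)\<close> in both coordinates. Conversely, both urn variables are supported on a lattice of
  spacing of order \<open>1 / n\<close>, while the beta distribution function increases at least linearly inside
  \<open>(0, 1)\<close>, so the distance cannot be smaller than order \<open>1 / n\<close>.
\<close>

section \<open>Estimates for quotients of the Gamma function\<close>

lemma Gamma_plus1_pos: "0 < x \<Longrightarrow> Gamma (x + 1) = x * Gamma x" for x :: real
  using Gamma_plus1[of x] nonpos_Ints_nonpos[of x] by auto

text \<open>By log-convexity the slope of \<open>ln \<circ> Gamma\<close> over [x, x + s] lies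
  between its slopes over [x - 1, x] and [x + s, x + s + 1]. The functional equation evaluates these
  two as ln (x - 1) and ln (x + s), whether or not s is an integer.\<close>

lemma Gamma_quotient_bounds:
  fixes x s :: real
  assumes "0 < s" "0 < x"
  shows "Gamma (x + s) / Gamma x \<le> (x + s) powr s"
    and "1 < x \<Longrightarrow> (x - 1) powr s \<le> Gamma (x + s) / Gamma x"
proof -
  have step: "ln (Gamma (y + 1)) = ln (Gamma y) + ln y" if "0 < y" for y :: real
    using that ln_mult_pos[of y "Gamma y"] Gamma_real_pos[OF that] by (simp add: Gamma_plus1_pos)
  have quot: "Gamma (x + s) / Gamma x = exp (ln (Gamma (x + s)) - ln (Gamma x))"
    using assms by (simp add: exp_diff)
  let ?f = "ln \<circ> Gamma :: real \<Rightarrow> real"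
  have "(?f x - ?f (x + s)) / (x - (x + s)) \<le> (?f x - ?f (x + s + 1)) / (x - (x + s + 1))"
    and "(?f x - ?f (x + s + 1)) / (x - (x + s + 1))
      \<le> (?f (x + s) - ?f (x + s + 1)) / ((x + s) - (x + s + 1))"
    using convex_on_slope_le[OF log_convex_Gamma_real, of x "x + s + 1" "x + s"] assms by auto
  then have "(ln (Gamma (x + s)) - ln (Gamma x)) / s \<le> ln (x + s)"
    using step[of "x + s"] assms by (simp add: divide_simps algebra_simps)
  then have "ln (Gamma (x + s)) - ln (Gamma x) \<le> s * ln (x + s)"
    using assms by (simp add: field_simps)
  then show "Gamma (x + s) / Gamma x \<le> (x + s) powr s"
    unfolding quot using assms by (simp add: powr_def)
  assume x: "1 < x"
  have "(?f (x - 1) - ?f x) / ((x - 1) - x) \<le> (?f (x - 1) - ?f (x + s)) / ((x - 1) - (x + s))"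
    and "(?f (x - 1) - ?f (x + s)) / ((x - 1) - (x + s)) \<le> (?f x - ?f (x + s)) / (x - (x + s))"
    using convex_on_slope_le[OF log_convex_Gamma_real, of "x - 1" "x + s" x] assms x by auto
  then have "ln (x - 1) \<le> (ln (Gamma (x + s)) - ln (Gamma x)) / s"
    using step[of "x - 1"] assms x by (simp add: divide_simps algebra_simps)
  then have "s * ln (x - 1) \<le> ln (Gamma (x + s)) - ln (Gamma x)"
    using assms by (simp add: field_simps)
  then show "(x - 1) powr s \<le> Gamma (x + s) / Gamma x"
    unfolding quot using x by (simp add: powr_def)
qed

text \<open>The quotient bounds replace ln x by ln (x + s) or ln (x - 1), at a cost of at most s / x
  or 1 / (x - 1). The latter is at most 2 / x because x \<ge> 2. Multiplied by s, the two costs are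
  added so that one constant serves both sides.\<close>

lemma ln_Gamma_quotient_approx:
  fixes x s :: real
  assumes "0 < s" "2 \<le> x"
  shows "\<bar>ln (Gamma (x + s) / Gamma x) - s * ln x\<bar> \<le> (2 * s + s\<^sup>2) / x"
proof -
  have pos: "0 < Gamma (x + s) / Gamma x" using assms by simp
  have "ln (Gamma (x + s) / Gamma x) \<le> ln ((x + s) powr s)"
    using Gamma_quotient_bounds(1)[of s x] assms pos by (subst ln_le_cancel_iff) auto
  then have up: "ln (Gamma (x + s) / Gamma x) \<le> s * ln (x + s)"
    using assms by (simp add: ln_powr)
  have "ln ((x - 1) powr s) \<le> ln (Gamma (x + s) / Gamma x)"
    using Gamma_quotient_bounds(2)[of s x] assms pos by (subst ln_le_cancel_iff) auto
  then have low: "s * ln (x - 1) \<le> ln (Gamma (x + s) / Gamma x)"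
    using assms by (simp add: ln_powr)
  have "ln (x + s) - ln x \<le> s / x"
    using ln_diff_le[of "x + s" x] assms by simp
  then have "s * (ln (x + s) - ln x) \<le> s * (s / x)"
    using assms by (intro mult_left_mono) auto
  moreover have "s * (s / x) \<le> (2 * s + s\<^sup>2) / x"
    using assms by (simp add: divide_simps power2_eq_square)
  ultimately have 1: "s * ln (x + s) - s * ln x \<le> (2 * s + s\<^sup>2) / x"
    by (simp add: algebra_simps)
  have "ln x - ln (x - 1) \<le> 1 / (x - 1)"
    using ln_diff_le[of x "x - 1"] assms by simp
  also have "\<dots> \<le> 2 / x"
    using assms by (simp add: divide_simps)
  finally have "s * (ln x - ln (x - 1)) \<le> s * (2 / x)"
    using assms by (intro mult_left_mono) auto
  moreover have "s * (2 / x) \<le> (2 * s + s\<^sup>2) / x"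
    using assms by (simp add: divide_simps)
  ultimately have 2: "s * ln x - s * ln (x - 1) \<le> (2 * s + s\<^sup>2) / x"
    by (simp add: algebra_simps)
  show ?thesis using up low 1 2 by linarith
qed

section \<open>The beta distribution function\<close>

text \<open>The half-open interval is a difference of intervals starting at 0, so x = 0 is covered
  even when p < 1 makes the integrand unbounded near 0.\<close>

lemma nn_integral_powr_interval:
  fixes x y p :: real
  assumes "0 < p" "0 \<le> x" "x \<le> y"
  shows "(\<integral>\<^sup>+w. ennreal (w powr (p - 1)) * indicator {x<..y} w \<partial>lborel)
    = ennreal ((y powr p - x powr p) / p)"
proof -
  have "((\<lambda>w. w powr (p - 1)) has_integral (y powr p / p - x powr p / p)) ({0..y} - {0..x})"
    using has_integral_powr_from_0[of "p - 1" y] has_integral_powr_from_0[of "p - 1" x] assms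
    by (intro has_integral_setdiff) auto
  moreover have "{0..y} - {0..x} = {x<..y}"
    using assms by auto
  ultimately have "((\<lambda>w. w powr (p - 1)) has_integral ((y powr p - x powr p) / p)) {x<..y}"
    by (simp add: diff_divide_distrib)
  from nn_integral_has_integral_lebesgue[OF _ this]
  have "(\<integral>\<^sup>+w. ennreal (indicator {x<..y} w * w powr (p - 1)) \<partial>lborel)
    = ennreal ((y powr p - x powr p) / p)" by simp
  moreover have "ennreal (indicator {x<..y} w * w powr (p - 1))
      = ennreal (w powr (p - 1)) * indicator {x<..y} w" for w
    by (simp split: split_indicator)
  ultimately show ?thesis by simp
qed

definition beta_distr :: "real \<Rightarrow> real \<Rightarrow> real measure" where
  "beta_distr \<alpha> \<beta> = density lborel (\<lambda>x. ennreal (beta_density \<alpha> \<beta> x))"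

lemma Beta_pos: "0 < Beta \<alpha> \<beta>" if "0 < \<alpha>" "0 < \<beta>" for \<alpha> \<beta> :: real
  using that by (simp add: Beta_def)

lemma beta_density_measurable [measurable]: "beta_density \<alpha> \<beta> \<in> borel_measurable borel"
  unfolding beta_density_def by measurable

lemma sets_beta_distr [measurable_cong, simp]: "sets (beta_distr \<alpha> \<beta>) = sets borel"
  by (simp add: beta_distr_def)

lemma space_beta_distr [simp]: "space (beta_distr \<alpha> \<beta>) = UNIV"
  by (simp add: beta_distr_def)

lemma real_distribution_beta_distr:
  assumes "0 < \<alpha>" "0 < \<beta>"
  shows "real_distribution (beta_distr \<alpha> \<beta>)"
proof -
  have "(\<integral>\<^sup>+x. ennreal (beta_density \<alpha> \<beta> x) \<partial>lborel)
    = (\<integral>\<^sup>+x. ennreal (indicator {0..1} x * (x powr (\<alpha> - 1) * (1 - x) powr (\<beta> - 1) / Beta \<alpha> \<beta>)) \<partial>lborel)"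
    by (intro nn_integral_cong) (auto simp: beta_density_def indicator_def)
  also have "\<dots> = ennreal (Beta \<alpha> \<beta> / Beta \<alpha> \<beta>)"
  proof -
    have 1: "((\<lambda>x. x powr (\<alpha> - 1) * (1 - x) powr (\<beta> - 1) / Beta \<alpha> \<beta>) has_integral Beta \<alpha> \<beta> / Beta \<alpha> \<beta>) {0..1}"
      using has_integral_divide[OF has_integral_Beta_real[OF assms], of "Beta \<alpha> \<beta>"] by simp
    show ?thesis
      using nn_integral_has_integral_lebesgue[OF _ 1] Beta_pos[OF assms] by simp
  qed
  finally have "emeasure (beta_distr \<alpha> \<beta>) UNIV = 1"
    using Beta_pos[OF assms] by (simp add: beta_distr_def emeasure_density)
  then have "prob_space (beta_distr \<alpha> \<beta>)"
    by (intro prob_spaceI) simp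
  then show ?thesis
    by (simp add: real_distribution_def real_distribution_axioms_def)
qed

definition beta_cdf :: "real \<Rightarrow> real \<Rightarrow> real \<Rightarrow> real" where
  "beta_cdf \<alpha> \<beta> = cdf (beta_distr \<alpha> \<beta>)"

context
  fixes \<alpha> \<beta> :: real
  assumes pos: "0 < \<alpha>" "0 < \<beta>"
begin

interpretation B: real_distribution "beta_distr \<alpha> \<beta>"
  using pos by (rule real_distribution_beta_distr)

lemma beta_cdf_mono: "x \<le> y \<Longrightarrow> beta_cdf \<alpha> \<beta> x \<le> beta_cdf \<alpha> \<beta> y"
  unfolding beta_cdf_def by (rule B.cdf_nondecreasing)

lemma beta_cdf_nonneg: "0 \<le> beta_cdf \<alpha> \<beta> x"
  unfolding beta_cdf_def by (rule B.cdf_nonneg)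

lemma beta_cdf_le_1: "beta_cdf \<alpha> \<beta> x \<le> 1"
  unfolding beta_cdf_def by (rule B.cdf_bounded_prob)

lemma beta_cdf_diff:
  assumes "x \<le> y"
  shows "ennreal (beta_cdf \<alpha> \<beta> y - beta_cdf \<alpha> \<beta> x)
    = (\<integral>\<^sup>+w. ennreal (beta_density \<alpha> \<beta> w) * indicator {x<..y} w \<partial>lborel)"
proof (cases "x = y")
  case False
  then have "beta_cdf \<alpha> \<beta> y - beta_cdf \<alpha> \<beta> x = measure (beta_distr \<alpha> \<beta>) {x<..y}"
    unfolding beta_cdf_def using assms by (intro B.cdf_diff_eq) auto
  then have "ennreal (beta_cdf \<alpha> \<beta> y - beta_cdf \<alpha> \<beta> x) = emeasure (beta_distr \<alpha> \<beta>) {x<..y}"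
    by (simp add: B.emeasure_eq_measure)
  then show ?thesis
    by (simp add: beta_distr_def emeasure_density)
qed simp

lemma beta_cdf_le_0:
  assumes "x \<le> 0"
  shows "beta_cdf \<alpha> \<beta> x = 0"
proof -
  have "emeasure (beta_distr \<alpha> \<beta>) {..x}
    = (\<integral>\<^sup>+w. ennreal (beta_density \<alpha> \<beta> w) * indicator {..x} w \<partial>lborel)"
    by (simp add: beta_distr_def emeasure_density)
  also have "\<dots> = (\<integral>\<^sup>+(w::real). 0 \<partial>lborel)"
    using assms by (intro nn_integral_cong) (auto simp: beta_density_def indicator_def)
  finally show ?thesis
    by (simp add: beta_cdf_def cdf_def measure_def)
qed

lemma beta_cdf_ge_1:
  assumes "1 \<le> x"
  shows "beta_cdf \<alpha> \<beta> x = 1"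
proof -
  have "emeasure (beta_distr \<alpha> \<beta>) {..x}
    = (\<integral>\<^sup>+w. ennreal (beta_density \<alpha> \<beta> w) * indicator {..x} w \<partial>lborel)"
    by (simp add: beta_distr_def emeasure_density)
  also have "\<dots> = (\<integral>\<^sup>+w. ennreal (beta_density \<alpha> \<beta> w) * indicator UNIV w \<partial>lborel)"
    using assms by (intro nn_integral_cong) (auto simp: beta_density_def indicator_def)
  also have "\<dots> = emeasure (beta_distr \<alpha> \<beta>) UNIV"
    unfolding beta_distr_def by (subst emeasure_density) auto
  also have "\<dots> = 1"
    using B.emeasure_space_1 by simp
  finally show ?thesis
    by (simp add: beta_cdf_def cdf_def measure_def)
qed

text \<open>Only the factor in 1 - w is estimated; the power of w is integrated exactly. Nothing is
  lost near 0, where the density is unbounded for \<alpha> < 1.\<close>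

lemma beta_cdf_diff_bounds:
  assumes xy: "0 \<le> x" "x \<le> y" "y < 1" and lo: "0 \<le> lo"
    and g: "\<And>w. x < w \<Longrightarrow> w \<le> y \<Longrightarrow> lo \<le> (1 - w) powr (\<beta> - 1) \<and> (1 - w) powr (\<beta> - 1) \<le> hi"
  shows "lo * ((y powr \<alpha> - x powr \<alpha>) / (\<alpha> * Beta \<alpha> \<beta>)) \<le> beta_cdf \<alpha> \<beta> y - beta_cdf \<alpha> \<beta> x"
    and "beta_cdf \<alpha> \<beta> y - beta_cdf \<alpha> \<beta> x \<le> hi * ((y powr \<alpha> - x powr \<alpha>) / (\<alpha> * Beta \<alpha> \<beta>))"
proof -
  note Bpos = Beta_pos[OF pos]
  have d: "0 \<le> y powr \<alpha> - x powr \<alpha>"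
    using xy pos by (simp add: powr_mono2)
  have scaled: "(\<integral>\<^sup>+w. ennreal (c / Beta \<alpha> \<beta> * w powr (\<alpha> - 1)) * indicator {x<..y} w \<partial>lborel)
      = ennreal (c * ((y powr \<alpha> - x powr \<alpha>) / (\<alpha> * Beta \<alpha> \<beta>)))" if "0 \<le> c" for c
  proof -
    have "(\<integral>\<^sup>+w. ennreal (c / Beta \<alpha> \<beta> * w powr (\<alpha> - 1)) * indicator {x<..y} w \<partial>lborel)
      = ennreal (c / Beta \<alpha> \<beta>) * (\<integral>\<^sup>+w. ennreal (w powr (\<alpha> - 1)) * indicator {x<..y} w \<partial>lborel)"
    proof -
      have "ennreal (c / Beta \<alpha> \<beta> * w powr (\<alpha> - 1)) * indicator {x<..y} w
        = ennreal (c / Beta \<alpha> \<beta>) * (ennreal (w powr (\<alpha> - 1)) * indicator {x<..y} w)" for w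
        using that Bpos by (subst ennreal_mult') (auto simp: mult.assoc)
      then show ?thesis by (simp add: nn_integral_cmult)
    qed
    then show ?thesis
      using nn_integral_powr_interval[of \<alpha> x y] pos xy that Bpos d
      by (simp add: ennreal_mult'[symmetric] mult_ac)
  qed
  have "ennreal (lo * ((y powr \<alpha> - x powr \<alpha>) / (\<alpha> * Beta \<alpha> \<beta>)))
      \<le> ennreal (beta_cdf \<alpha> \<beta> y - beta_cdf \<alpha> \<beta> x)"
    unfolding scaled[OF lo, symmetric] beta_cdf_diff[OF xy(2)]
  proof (intro nn_integral_mono)
    fix w
    show "ennreal (lo / Beta \<alpha> \<beta> * w powr (\<alpha> - 1)) * indicator {x<..y} w
      \<le> ennreal (beta_density \<alpha> \<beta> w) * indicator {x<..y} w"
    proof (cases "w \<in> {x<..y}")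
      case True
      then have "lo / Beta \<alpha> \<beta> * w powr (\<alpha> - 1) \<le> beta_density \<alpha> \<beta> w"
        using g[of w] xy Bpos mult_left_mono[of lo "(1 - w) powr (\<beta> - 1)" "w powr (\<alpha> - 1)"]
        by (auto simp: beta_density_def divide_simps mult_ac)
      with True show ?thesis by (simp add: ennreal_leI)
    qed simp
  qed
  moreover have "0 \<le> beta_cdf \<alpha> \<beta> y - beta_cdf \<alpha> \<beta> x"
    using beta_cdf_mono[OF xy(2)] by simp
  ultimately show "lo * ((y powr \<alpha> - x powr \<alpha>) / (\<alpha> * Beta \<alpha> \<beta>)) \<le> beta_cdf \<alpha> \<beta> y - beta_cdf \<alpha> \<beta> x"
    by (simp add: ennreal_le_iff)
  show "beta_cdf \<alpha> \<beta> y - beta_cdf \<alpha> \<beta> x \<le> hi * ((y powr \<alpha> - x powr \<alpha>) / (\<alpha> * Beta \<alpha> \<beta>))"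
  \<comment> \<open>Only a nonempty interval lets the bounds on the factor force \<open>hi\<close>
    to be nonnegative.\<close>
  proof (cases "x = y")
    case False
    then have "0 \<le> hi" using g[of y] xy lo by auto
    have "ennreal (beta_cdf \<alpha> \<beta> y - beta_cdf \<alpha> \<beta> x)
      \<le> ennreal (hi * ((y powr \<alpha> - x powr \<alpha>) / (\<alpha> * Beta \<alpha> \<beta>)))"
      unfolding scaled[OF \<open>0 \<le> hi\<close>, symmetric] beta_cdf_diff[OF xy(2)]
    proof (intro nn_integral_mono)
      fix w
      show "ennreal (beta_density \<alpha> \<beta> w) * indicator {x<..y} w
        \<le> ennreal (hi / Beta \<alpha> \<beta> * w powr (\<alpha> - 1)) * indicator {x<..y} w"
      proof (cases "w \<in> {x<..y}")
        case True
        then have "beta_density \<alpha> \<beta> w \<le> hi / Beta \<alpha> \<beta> * w powr (\<alpha> - 1)"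
          using g[of w] xy Bpos mult_left_mono[of "(1 - w) powr (\<beta> - 1)" hi "w powr (\<alpha> - 1)"]
          by (auto simp: beta_density_def divide_simps mult_ac)
        with True show ?thesis by (simp add: ennreal_leI)
      qed simp
    qed
    moreover have "0 \<le> hi * ((y powr \<alpha> - x powr \<alpha>) / (\<alpha> * Beta \<alpha> \<beta>))"
      using \<open>0 \<le> hi\<close> d pos Bpos by simp
    ultimately show ?thesis by (simp add: ennreal_le_iff)
  qed simp
qed

text \<open>On (0, 1) a power with exponent |e| is nondecreasing and at most the power with exponent
  e. Hence the values at l and 1 - r bound both factors of the density from below, whatever the
  signs of \<alpha> - 1 and \<beta> - 1.\<close>

lemma beta_cdf_lower_Lipschitz:
  assumes lr: "0 < l" "l \<le> x" "x \<le> y" "y \<le> r" "r < 1"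
  shows "l powr \<bar>\<alpha> - 1\<bar> * (1 - r) powr \<bar>\<beta> - 1\<bar> / Beta \<alpha> \<beta> * (y - x)
    \<le> beta_cdf \<alpha> \<beta> y - beta_cdf \<alpha> \<beta> x"
proof -
  note Bpos = Beta_pos[OF pos]
  define m where "m = l powr \<bar>\<alpha> - 1\<bar> * (1 - r) powr \<bar>\<beta> - 1\<bar> / Beta \<alpha> \<beta>"
  have m: "0 \<le> m" using Bpos by (simp add: m_def)
  have powr_ge: "u powr \<bar>e\<bar> \<le> v powr e" if "0 < u" "u \<le> v" "v < 1" for u v e :: real
  proof -
    have "u powr \<bar>e\<bar> \<le> v powr \<bar>e\<bar>" using that by (intro powr_mono2) auto
    also have "\<dots> \<le> v powr e" using that by (intro powr_mono') auto
    finally show ?thesis .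
  qed
  have "ennreal (m * (y - x)) = (\<integral>\<^sup>+w. ennreal m * indicator {x<..y} w \<partial>lborel)"
    using lr m by (simp add: nn_integral_cmult ennreal_mult')
  also have "\<dots> \<le> ennreal (beta_cdf \<alpha> \<beta> y - beta_cdf \<alpha> \<beta> x)"
    unfolding beta_cdf_diff[OF lr(3)]
  proof (intro nn_integral_mono)
    fix w
    show "ennreal m * indicator {x<..y} w \<le> ennreal (beta_density \<alpha> \<beta> w) * indicator {x<..y} w"
    proof (cases "w \<in> {x<..y}")
      case True
      then have "l powr \<bar>\<alpha> - 1\<bar> * (1 - r) powr \<bar>\<beta> - 1\<bar>
          \<le> w powr (\<alpha> - 1) * (1 - w) powr (\<beta> - 1)"
        using lr by (intro mult_mono powr_ge) auto
      then have "m \<le> beta_density \<alpha> \<beta> w"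
        using True lr Bpos by (auto simp: m_def beta_density_def divide_right_mono)
      then show ?thesis by (simp add: ennreal_leI mult_right_mono)
    qed simp
  qed
  finally show ?thesis
    using beta_cdf_mono[OF lr(3)] unfolding m_def by (simp add: ennreal_le_iff)
qed

section \<open>Reflection of the beta law\<close>

lemma beta_distr_reflect: "distr (beta_distr \<alpha> \<beta>) lborel (\<lambda>x. 1 - x) = beta_distr \<beta> \<alpha>"
proof -
  have "distributed (beta_distr \<alpha> \<beta>) lborel (\<lambda>x. x) (\<lambda>x. ennreal (beta_density \<alpha> \<beta> x))"
    by (auto simp: distributed_def beta_distr_def distr_id2)
  from B.distributed_affine[OF this, of "-1" 1]
  have "distr (beta_distr \<alpha> \<beta>) lborel (\<lambda>x. 1 - x)
    = density lborel (\<lambda>x. ennreal (beta_density \<alpha> \<beta> (1 - x)))"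
    by (simp add: distributed_def divide_ennreal_def)
  also have "(\<lambda>x. beta_density \<alpha> \<beta> (1 - x)) = beta_density \<beta> \<alpha>"
    by (auto simp: beta_density_def fun_eq_iff Beta_commute)
  finally show ?thesis by (simp add: beta_distr_def)
qed

lemma beta_cdf_reflect: "beta_cdf \<beta> \<alpha> x = 1 - beta_cdf \<alpha> \<beta> (1 - x)"
proof -
  \<comment> \<open>The reflected event contains its endpoint 1 - x, while the complement of
    \<open>{..1 - x}\<close> does not; the difference is this null point.\<close>
  have null: "measure (beta_distr \<alpha> \<beta>) {1 - x} = 0"
  proof -
    have "emeasure (beta_distr \<alpha> \<beta>) {1 - x} = 0"
      unfolding beta_distr_def by (subst emeasure_density) (auto simp: nn_integral_cmult_indicator)
    then show ?thesis by (simp add: measure_def)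
  qed
  have "beta_cdf \<beta> \<alpha> x = measure (distr (beta_distr \<alpha> \<beta>) lborel (\<lambda>x. 1 - x)) {..x}"
    by (simp add: beta_cdf_def cdf_def beta_distr_reflect)
  also have "\<dots> = measure (beta_distr \<alpha> \<beta>) {1 - x..}"
    by (subst measure_distr) (auto intro!: arg_cong2[where f = measure])
  also have "{1 - x..} = {1 - x} \<union> (UNIV - {..1 - x})" by auto
  also have "measure (beta_distr \<alpha> \<beta>) \<dots> = measure (beta_distr \<alpha> \<beta>) {1 - x}
      + measure (beta_distr \<alpha> \<beta>) (UNIV - {..1 - x})"
    by (rule B.finite_measure_Union) auto
  also have "\<dots> = 1 - beta_cdf \<alpha> \<beta> (1 - x)"
    using null B.prob_compl[of "{..1 - x}"] by (simp add: beta_cdf_def cdf_def)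
  finally show ?thesis .
qed

end

section \<open>The beta-binomial distribution\<close>

definition beta_binomial :: "real \<Rightarrow> real \<Rightarrow> nat \<Rightarrow> nat \<Rightarrow> real" where
  "beta_binomial \<alpha> \<beta> n k =
    real (n choose k) * pochhammer \<alpha> k * pochhammer \<beta> (n - k) / pochhammer (\<alpha> + \<beta>) n"

text \<open>Since \<open>Gamma 0 = 0\<close> and \<open>x / 0 = 0\<close>, the first cell starts at \<open>cell_end \<alpha> 0 = 0\<close>.\<close>
definition cell_end :: "real \<Rightarrow> nat \<Rightarrow> real" where
  "cell_end \<alpha> k = (Gamma (real k + \<alpha>) / Gamma (real k)) powr (1 / \<alpha>)"

context
  fixes \<alpha> \<beta> :: real
  assumes pos: "0 < \<alpha>" "0 < \<beta>"
begin

lemma beta_binomial_nonneg: "0 \<le> beta_binomial \<alpha> \<beta> n k"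
  using pos by (auto simp: beta_binomial_def intro!: divide_nonneg_nonneg mult_nonneg_nonneg pochhammer_nonneg)

lemma sum_beta_binomial: "(\<Sum>k\<le>n. beta_binomial \<alpha> \<beta> n k) = 1"
proof -
  have "(\<Sum>k\<le>n. beta_binomial \<alpha> \<beta> n k) = pochhammer (\<alpha> + \<beta>) n / pochhammer (\<alpha> + \<beta>) n"
    by (simp add: beta_binomial_def pochhammer_binomial_sum flip: sum_divide_distrib)
  also have "\<dots> = 1" using pos pochhammer_pos[of "\<alpha> + \<beta>" n] by simp
  finally show ?thesis .
qed

lemma beta_binomial_reflect: "k \<le> n \<Longrightarrow> beta_binomial \<alpha> \<beta> n (n - k) = beta_binomial \<beta> \<alpha> n k"
  by (simp add: beta_binomial_def binomial_symmetric[of k n] add.commute mult_ac)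

text \<open>This form separates an \<alpha>-factor in k, a \<beta>-factor in n - k and a factor in
  n. The first will be matched exactly by a cell, the other two only asymptotically.\<close>

lemma beta_binomial_Gamma:
  assumes "k \<le> n"
  shows "beta_binomial \<alpha> \<beta> n k = Gamma (real k + \<alpha>) / Gamma (real k + 1)
    * (Gamma (real (n - k) + \<beta>) / Gamma (real (n - k) + 1))
    * (Gamma (real n + 1) / Gamma (real n + (\<alpha> + \<beta>))) / Beta \<alpha> \<beta>"
proof -
  have nonpos: "x \<notin> \<int>\<^sub>\<le>\<^sub>0" if "0 < x" for x :: real
    using that nonpos_Ints_nonpos[of x] by auto
  have nz: "Gamma x \<noteq> 0" if "0 < x" for x :: real
    using Gamma_real_pos[OF that] by simp
  have fact: "fact j = Gamma (real j + 1)" for j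
    using Gamma_fact[of j, where 'a = real] by (simp add: add.commute)
  show ?thesis
    unfolding beta_binomial_def binomial_fact[OF assms, where 'a = real] Beta_def
    using pos
    by (simp add: fact pochhammer_Gamma nonpos nz field_simps)
qed

section \<open>Cells of the beta law that match the beta-binomial weights\<close>

lemma cell_end_nonneg: "0 \<le> cell_end \<alpha> k"
  by (simp add: cell_end_def)

lemma cell_end_powr: "cell_end \<alpha> k powr \<alpha> = Gamma (real k + \<alpha>) / Gamma (real k)"
proof -
  have "0 \<le> Gamma (real k + \<alpha>) / Gamma (real k)"
    using pos by (cases "k = 0") auto
  then show ?thesis
    unfolding cell_end_def powr_powr using pos powr_one[of "Gamma (real k + \<alpha>) / Gamma (real k)"] by simp
qed

text \<open>The reason for choosing these endpoints: divided by \<alpha>, the left side is the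
  integral of the \<alpha>-power in the density over a cell. For k > 0 the functional equation
  reduces the claim to (k + \<alpha>) / k - 1 = \<alpha> / k.\<close>

lemma cell_end_powr_diff:
  "cell_end \<alpha> (Suc k) powr \<alpha> - cell_end \<alpha> k powr \<alpha> = \<alpha> * (Gamma (real k + \<alpha>) / Gamma (real k + 1))"
\<comment> \<open>The case is separate because the default value \<open>Gamma 0 = 0\<close> violates
  the functional equation.\<close>
proof (cases "k = 0")
  case True
  then show ?thesis
    using pos Gamma_plus1_pos[of \<alpha>] by (simp add: cell_end_powr add.commute)
next
  case False
  define g h where "g = Gamma (real k + \<alpha>)" and "h = Gamma (real k)"
  have "0 < h" using False by (simp add: h_def)
  have 1: "Gamma (real (Suc k) + \<alpha>) = (real k + \<alpha>) * g"
    using pos Gamma_plus1_pos[of "real k + \<alpha>"] by (simp add: add_ac g_def)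
  have 2: "Gamma (real k + 1) = real k * h" "Gamma (real (Suc k)) = real k * h"
    using False Gamma_plus1_pos[of "real k"] by (simp_all add: h_def add.commute)
  show ?thesis
    unfolding cell_end_powr 1 2 g_def[symmetric] h_def[symmetric]
    using False \<open>0 < h\<close> by (simp add: field_simps)
qed

lemma cell_end_mono: "cell_end \<alpha> k \<le> cell_end \<alpha> (Suc k)"
proof (rule ccontr)
  assume "\<not> ?thesis"
  then have "cell_end \<alpha> (Suc k) powr \<alpha> < cell_end \<alpha> k powr \<alpha>"
    using pos(1) cell_end_nonneg[of "Suc k"] by (intro powr_less_mono2) auto
  moreover have "0 \<le> cell_end \<alpha> (Suc k) powr \<alpha> - cell_end \<alpha> k powr \<alpha>"
    unfolding cell_end_powr_diff using pos by (intro mult_nonneg_nonneg divide_nonneg_nonneg Gamma_real_nonneg) auto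
  ultimately show False
    by simp
qed

lemma cell_end_le: "cell_end \<alpha> k \<le> real k + \<alpha>"
proof (cases "k = 0")
  case True
  then show ?thesis using pos by (simp add: cell_end_def)
next
  case False
  then have "cell_end \<alpha> k powr \<alpha> \<le> (real k + \<alpha>) powr \<alpha>"
    using pos Gamma_quotient_bounds(1)[of \<alpha> "real k"] by (simp add: cell_end_powr)
  then show ?thesis
    using pos powr_less_mono2[of \<alpha> "real k + \<alpha>" "cell_end \<alpha> k"] by force
qed

lemma cell_end_ge: "real k - 1 \<le> cell_end \<alpha> k"
proof (cases "k \<le> 1")
  case True
  then show ?thesis using cell_end_nonneg[of k] by linarith
next
  case False
  then have "(real k - 1) powr \<alpha> \<le> cell_end \<alpha> k powr \<alpha>"
    using pos Gamma_quotient_bounds(2)[of \<alpha> "real k"] by (simp add: cell_end_powr)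
  then show ?thesis
    using pos cell_end_nonneg[of k] powr_less_mono2[of \<alpha> "cell_end \<alpha> k" "real k - 1"] by force
qed

text \<open>The three summands of \<open>A\<close> come from the \<beta>-factor (doubled because n -
  j \<ge> n / 2), from the factor in n, and from the variation of the remaining density factor over
  the cell. The conditions on n keep the Gamma arguments at least 2 and the cell at distance at
  least 1 / 4 from 1.\<close>

lemma beta_binomial_cell:
  defines "A \<equiv> (2 * (2 * \<beta> + \<beta>\<^sup>2) + (2 * (\<alpha> + \<beta>) + (\<alpha> + \<beta>)\<^sup>2)) + \<bar>\<beta> - 1\<bar> * (4 * (1 + \<alpha>))"
  assumes n: "4 \<le> n" "4 * (1 + \<alpha>) \<le> real n" and j: "2 * j \<le> n"
  defines "q \<equiv> beta_cdf \<alpha> \<beta> (cell_end \<alpha> (Suc j) / n) - beta_cdf \<alpha> \<beta> (cell_end \<alpha> j / n)"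
  shows "exp (- (A / n)) * q \<le> beta_binomial \<alpha> \<beta> n j" "beta_binomial \<alpha> \<beta> n j \<le> exp (A / n) * q"
proof -
  define m where "m = real (n - j)"
  define r where "r = real n"
  define s where "s = \<alpha> + \<beta>"
  have r: "4 \<le> r" "4 * (1 + \<alpha>) \<le> r" using n by (auto simp: r_def)
  have m: "m = r - real j" "r / 2 \<le> m" "2 \<le> m" using j n by (auto simp: m_def r_def)
  have s: "0 < s" using pos by (simp add: s_def)
  note Bpos = Beta_pos[OF pos]
  \<comment> \<open>\<open>K * G\<close> is the common main term: \<open>K\<close> is the exact
    integral over the cell with the factor in 1 - w left out, and \<open>G\<close> is that factor at
    w = j / n.\<close>
  define K where "K = Gamma (real j + \<alpha>) / Gamma (real j + 1) / (r powr \<alpha> * Beta \<alpha> \<beta>)"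
  define G where "G = (m / r) powr (\<beta> - 1)"
  have K: "0 < K" using pos Bpos r by (simp add: K_def)
  \<comment> \<open>\<open>u\<close> and \<open>v\<close> are the logarithmic errors in replacing
    the two Gamma quotients by \<open>m powr \<beta>\<close> and \<open>r powr s\<close>.\<close>
  define u where "u = ln (Gamma (m + \<beta>) / Gamma m) - \<beta> * ln m"
  define v where "v = ln (Gamma (r + s) / Gamma r) - s * ln r"
  have "\<bar>u\<bar> \<le> (2 * \<beta> + \<beta>\<^sup>2) / m"
    unfolding u_def using pos m by (intro ln_Gamma_quotient_approx)
  also have "\<dots> \<le> (2 * \<beta> + \<beta>\<^sup>2) / (r / 2)"
    using pos m r by (intro divide_left_mono) auto
  finally have u: "\<bar>u\<bar> \<le> 2 * (2 * \<beta> + \<beta>\<^sup>2) / r" by (simp add: mult.commute)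
  have v: "\<bar>v\<bar> \<le> (2 * s + s\<^sup>2) / r"
    unfolding v_def using s r by (intro ln_Gamma_quotient_approx) auto
  define A2 where "A2 = 2 * (2 * \<beta> + \<beta>\<^sup>2) + (2 * s + s\<^sup>2)"
  have uv: "\<bar>u - v\<bar> \<le> A2 / r" using u v by (simp add: A2_def add_divide_distrib)
  have M: "Gamma (m + \<beta>) / Gamma m = exp (u + \<beta> * ln m)"
    using pos m by (simp add: u_def)
  have R: "Gamma (r + s) / Gamma r = exp (v + s * ln r)"
    using s r by (simp add: v_def)
  \<comment> \<open>The functional equation lowers the exponents by one, leaving
    \<open>m powr (\<beta> - 1) * r powr (1 - s)\<close>. Since
    \<open>s = \<alpha> + \<beta>\<close>, this is \<open>G\<close> times
    \<open>r powr (- \<alpha>)\<close>, and the latter already sits in \<open>K\<close>.\<close>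
  have p: "beta_binomial \<alpha> \<beta> n j = K * G * exp (u - v)"
  proof -
    have M': "Gamma (m + \<beta>) / Gamma (m + 1) = exp (u + \<beta> * ln m - ln m)"
    proof -
      have "Gamma (m + \<beta>) / Gamma (m + 1) = Gamma (m + \<beta>) / Gamma m / m"
        using Gamma_plus1_pos[of m] m(3) by simp
      then show ?thesis unfolding M exp_diff using m(3) by simp
    qed
    have R': "Gamma (r + 1) / Gamma (r + s) = exp (ln r - (v + s * ln r))"
    proof -
      have "Gamma (r + 1) / Gamma (r + s) = r / (Gamma (r + s) / Gamma r)"
        using Gamma_plus1_pos[of r] r by simp
      then show ?thesis unfolding R exp_diff using r by simp
    qed
    have "beta_binomial \<alpha> \<beta> n j = K * (r powr \<alpha> *
        (exp (u + \<beta> * ln m - ln m) * exp (ln r - (v + s * ln r))))"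
      using j M' R' Bpos r
      by (simp add: beta_binomial_Gamma m_def[symmetric] r_def[symmetric] s_def[symmetric] K_def)
    also have "r powr \<alpha> * (exp (u + \<beta> * ln m - ln m) * exp (ln r - (v + s * ln r)))
      = G * exp (u - v)"
      using m r by (simp add: G_def powr_def ln_div s_def flip: exp_add) (simp add: algebra_simps)
    finally show ?thesis by simp
  qed
  define x where "x = cell_end \<alpha> j / r"
  define y where "y = cell_end \<alpha> (Suc j) / r"
  define A1 where "A1 = \<bar>\<beta> - 1\<bar> * (4 * (1 + \<alpha>))"
  have y_le: "y \<le> (real j + 1 + \<alpha>) / r"
    unfolding y_def using cell_end_le[of "Suc j"] r by (intro divide_right_mono) auto
  have x_ge: "(real j - 1) / r \<le> x"
    unfolding x_def using cell_end_ge[of j] r by (intro divide_right_mono) auto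
  have mr: "m / r = 1 - real j / r" "1 / 2 \<le> m / r" using m r by (auto simp: field_simps)
  have C: "(1 + \<alpha>) / r \<le> 1 / 4" using r by (simp add: field_simps)
  have bounds: "G * exp (- (A1 / r)) \<le> (1 - w) powr (\<beta> - 1) \<and> (1 - w) powr (\<beta> - 1) \<le> G * exp (A1 / r)"
    if w: "x < w" "w \<le> y" for w
  proof -
    \<comment> \<open>The endpoint bounds place w between (j - 1) / n and (j + 1 + \<alpha>) / n,
      while \<open>m / r\<close> is 1 - j / n.\<close>
    have d: "\<bar>(1 - w) - m / r\<bar> \<le> (1 + \<alpha>) / r"
    proof -
      have "0 \<le> \<alpha> / r" using pos r by simp
      then show ?thesis
        using w y_le x_ge mr(1) unfolding add_divide_distrib diff_divide_distrib by linarith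
    qed
    then have w1: "1 / 4 \<le> 1 - w" using mr C by linarith
    \<comment> \<open>Both arguments are at least 1 / 4, where the logarithm has Lipschitz constant
      4.\<close>
    have "\<bar>ln (1 - w) - ln (m / r)\<bar> \<le> 4 * (1 + \<alpha>) / r"
    proof -
      have a: "ln a - ln b \<le> 4 * (1 + \<alpha>) / r" if "1 / 4 \<le> a" "1 / 4 \<le> b" "\<bar>a - b\<bar> \<le> (1 + \<alpha>) / r" for a b
      proof -
        have "ln a - ln b \<le> (a - b) / b" using that by (intro ln_diff_le) auto
        also have "\<dots> \<le> \<bar>a - b\<bar> / b" using that by (intro divide_right_mono) auto
        also have "\<dots> \<le> ((1 + \<alpha>) / r) / (1 / 4)" using that by (intro frac_le) auto
        finally show ?thesis by (simp add: mult.commute)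
      qed
      show ?thesis
        using a[of "1 - w" "m / r"] a[of "m / r" "1 - w"] d w1 mr by (simp add: abs_le_iff abs_minus_commute)
    qed
    then have "\<bar>\<beta> - 1\<bar> * \<bar>ln (1 - w) - ln (m / r)\<bar> \<le> \<bar>\<beta> - 1\<bar> * (4 * (1 + \<alpha>) / r)"
      by (intro mult_left_mono) auto
    then have e: "\<bar>(\<beta> - 1) * (ln (1 - w) - ln (m / r))\<bar> \<le> A1 / r"
      by (simp add: abs_mult A1_def)
    have "(1 - w) powr (\<beta> - 1) = G * exp ((\<beta> - 1) * (ln (1 - w) - ln (m / r)))"
      using w1 mr m(3) r(1) by (simp add: G_def powr_def algebra_simps flip: exp_add)
    then show ?thesis
      using e by (auto simp: G_def abs_le_iff intro!: mult_left_mono)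
  qed
  have xy: "0 \<le> x" "x \<le> y" "y < 1"
  proof -
    show "0 \<le> x" using cell_end_nonneg r by (simp add: x_def)
    show "x \<le> y" using cell_end_mono r by (simp add: x_def y_def divide_right_mono)
    have "(real j + 1 + \<alpha>) / r = real j / r + (1 + \<alpha>) / r" by (simp add: add_divide_distrib)
    then show "y < 1" using y_le mr C by linarith
  qed
  have diff: "(y powr \<alpha> - x powr \<alpha>) / (\<alpha> * Beta \<alpha> \<beta>) = K"
  proof -
    have "y powr \<alpha> - x powr \<alpha> = (cell_end \<alpha> (Suc j) powr \<alpha> - cell_end \<alpha> j powr \<alpha>) / r powr \<alpha>"
      using r cell_end_nonneg by (simp add: x_def y_def powr_divide diff_divide_distrib)
    then show ?thesis
      using pos Bpos r by (simp add: cell_end_powr_diff K_def field_simps)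
  qed
  have q: "q = beta_cdf \<alpha> \<beta> y - beta_cdf \<alpha> \<beta> x"
    by (simp add: q_def x_def y_def r_def)
  have lo: "G * exp (- (A1 / r)) * K \<le> q" and hi: "q \<le> G * exp (A1 / r) * K"
    using beta_cdf_diff_bounds[OF pos xy _ bounds] by (auto simp: diff q G_def)
  have KG: "0 \<le> K * G" using K by (simp add: G_def)
  have A: "A = A2 + A1" by (simp add: A_def A1_def A2_def s_def)
  \<comment> \<open>Cell mass and weight both deviate from \<open>K * G\<close>, by exponents
    \<open>A1 / r\<close> and \<open>A2 / r\<close> respectively; comparing them adds the
    exponents.\<close>
  have "exp (- (A / n)) * q \<le> exp (- (A / n)) * (G * exp (A1 / r) * K)"
    using hi by (intro mult_left_mono) auto
  also have "\<dots> = K * G * exp (- (A2 / r))"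
    by (simp add: A r_def add_divide_distrib exp_diff exp_minus field_simps exp_add)
  also have "\<dots> \<le> K * G * exp (u - v)"
    using KG uv by (intro mult_left_mono) (auto simp: abs_le_iff)
  finally show "exp (- (A / n)) * q \<le> beta_binomial \<alpha> \<beta> n j" using p by simp
  have "K * G * exp (u - v) \<le> K * G * exp (A2 / r)"
    using KG uv by (intro mult_left_mono) auto
  also have "\<dots> = exp (A / n) * (G * exp (- (A1 / r)) * K)"
    by (simp add: A r_def add_divide_distrib exp_diff exp_minus field_simps exp_add)
  also have "\<dots> \<le> exp (A / n) * q"
    using lo by (intro mult_left_mono) auto
  finally show "beta_binomial \<alpha> \<beta> n j \<le> exp (A / n) * q" using p by simp
qed

end

section \<open>Comparison of distribution functions\<close>

context
  fixes \<alpha> \<beta> :: real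
  assumes pos: "0 < \<alpha>" "0 < \<beta>"
begin

text \<open>The cell estimates are summed; the cell masses telescope, and a relative error is also
  an absolute one because distribution functions are at most 1. The free point z stands for the
  horizontal error that the distance tolerates.\<close>

lemma beta_binomial_cdf_left:
  "\<exists>C>0. \<forall>n\<ge>1. \<forall>k. 2 * k \<le> n \<longrightarrow>
    (\<exists>z. \<bar>z - real k\<bar> \<le> C \<and> \<bar>(\<Sum>j\<le>k. beta_binomial \<alpha> \<beta> n j) - beta_cdf \<alpha> \<beta> (z / real n)\<bar> \<le> C / real n)"
proof -
  define A where "A = (2 * (2 * \<beta> + \<beta>\<^sup>2) + (2 * (\<alpha> + \<beta>) + (\<alpha> + \<beta>)\<^sup>2)) + \<bar>\<beta> - 1\<bar> * (4 * (1 + \<alpha>))"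
  have A: "0 \<le> A" using pos by (simp add: A_def)
  \<comment> \<open>The first two summands make C \<le> n imply the hypotheses on n of the cell
    estimate; \<open>2 * A\<close> bounds the accumulated error.\<close>
  define C where "C = 4 + 4 * (1 + \<alpha>) + 2 * A"
  have C: "0 < C" using A pos by (simp add: C_def)
  show ?thesis
  proof (rule exI[of _ C], intro conjI C allI impI)
    fix n k :: nat
    assume n: "1 \<le> n" and k: "2 * k \<le> n"
    define S where "S = (\<Sum>j\<le>k. beta_binomial \<alpha> \<beta> n j)"
    have S: "0 \<le> S" "S \<le> 1"
    proof -
      show "0 \<le> S" using beta_binomial_nonneg[OF pos] by (simp add: S_def sum_nonneg)
      have "S \<le> (\<Sum>j\<le>n. beta_binomial \<alpha> \<beta> n j)"
        unfolding S_def using k beta_binomial_nonneg[OF pos] by (intro sum_mono2) auto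
      then show "S \<le> 1" by (simp add: sum_beta_binomial[OF pos])
    qed
    show "\<exists>z. \<bar>z - real k\<bar> \<le> C \<and> \<bar>S - beta_cdf \<alpha> \<beta> (z / real n)\<bar> \<le> C / real n"
    proof (cases "C \<le> real n")
      \<comment> \<open>For n < C the claim is trivial: both values lie in [0, 1] and C / n exceeds
        1.\<close>
      case False
      then have "\<bar>S - beta_cdf \<alpha> \<beta> (real k / real n)\<bar> \<le> 1" "1 \<le> C / real n"
        using S beta_cdf_nonneg[OF pos, of "real k / n"] beta_cdf_le_1[OF pos, of "real k / n"] n
        by (auto simp: abs_le_iff)
      then show ?thesis using C by (intro exI[of _ "real k"]) auto
    next
      case True
      define z where "z = cell_end \<alpha> (Suc k)"
      define F where "F = beta_cdf \<alpha> \<beta> (z / real n)"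
      define q where "q j = beta_cdf \<alpha> \<beta> (cell_end \<alpha> (Suc j) / real n) - beta_cdf \<alpha> \<beta> (cell_end \<alpha> j / real n)" for j
      have F: "0 \<le> F" "F \<le> 1"
        using beta_cdf_nonneg[OF pos] beta_cdf_le_1[OF pos] by (auto simp: F_def)
      \<comment> \<open>The sum telescopes to the right end of cell k; the left end of cell 0 is 0,
        where the beta distribution function vanishes.\<close>
      have "(\<Sum>j\<le>k. q j) = F - beta_cdf \<alpha> \<beta> (cell_end \<alpha> 0 / real n)"
        unfolding q_def F_def z_def by (induction k) auto
      then have sum_q: "(\<Sum>j\<le>k. q j) = F"
        by (simp add: cell_end_def beta_cdf_le_0[OF pos])
      have "4 \<le> n" "4 * (1 + \<alpha>) \<le> real n"
        using True A pos by (auto simp: C_def)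
      note cell = beta_binomial_cell[OF pos this, folded A_def q_def]
      have lo: "exp (- (A / n)) * F \<le> S"
        unfolding sum_q[symmetric] S_def sum_distrib_left using k by (intro sum_mono cell(1)) auto
      have hi: "S \<le> exp (A / n) * F"
        unfolding sum_q[symmetric] S_def sum_distrib_left using k by (intro sum_mono cell(2)) auto
      \<comment> \<open>As e \<le> 1, exp e is at most 1 + 2 * e, and F \<le> 1 turns this factor
        into an additive error of 2 * e.\<close>
      define e where "e = A / real n"
      have e: "0 \<le> e" "e \<le> 1"
        using A True n pos by (auto simp: e_def C_def divide_simps)
      have "exp e \<le> 1 + e + e\<^sup>2" using e by (intro exp_bound) auto
      also have "e\<^sup>2 \<le> e" using e by (simp add: power2_eq_square mult_left_le)
      finally have "exp e * F \<le> (1 + 2 * e) * F" using F by (intro mult_right_mono) auto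
      also have "\<dots> \<le> F + 2 * e" using F e mult_left_mono[of F 1 e] by (simp add: algebra_simps)
      finally have "S - F \<le> 2 * e" using hi by (simp add: e_def)
      moreover have "F - S \<le> 2 * e"
      proof -
        have "(1 - e) * F \<le> exp (- e) * F"
          using F exp_ge_add_one_self[of "- e"] by (intro mult_right_mono) auto
        then have "F - S \<le> e * F" using lo by (simp add: e_def algebra_simps)
        also have "\<dots> \<le> 2 * e" using F e mult_left_mono[of F 1 e] by simp
        finally show ?thesis .
      qed
      moreover have "2 * e \<le> C / real n"
      proof -
        have "2 * A \<le> C" using pos by (simp add: C_def)
        then have "2 * A / real n \<le> C / real n" by (intro divide_right_mono) auto
        then show ?thesis by (simp add: e_def)
      qed
      ultimately have "\<bar>S - F\<bar> \<le> C / real n" by linarith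
      moreover have "\<bar>z - real k\<bar> \<le> C"
        using cell_end_le[OF pos, of "Suc k"] cell_end_ge[OF pos, of "Suc k"] pos A
        by (simp add: z_def C_def abs_le_iff)
      ultimately show ?thesis unfolding F_def by blast
    qed
  qed
qed

end

text \<open>For k beyond n / 2, counting the other colour exchanges \<alpha> and \<beta> and turns
  the upper tail into a lower sum of at most half length.\<close>

lemma beta_binomial_cdf_approx:
  assumes pos: "0 < \<alpha>" "0 < \<beta>"
  shows "\<exists>C>0. \<forall>n\<ge>1. \<forall>k<n.
    (\<exists>z. \<bar>z - real k\<bar> \<le> C \<and> \<bar>(\<Sum>j\<le>k. beta_binomial \<alpha> \<beta> n j) - beta_cdf \<alpha> \<beta> (z / real n)\<bar> \<le> C / real n)"
proof -
  obtain C1 where C1: "0 < C1" and left: "\<And>n k. 1 \<le> n \<Longrightarrow> 2 * k \<le> n \<Longrightarrow>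
    \<exists>z. \<bar>z - real k\<bar> \<le> C1 \<and> \<bar>(\<Sum>j\<le>k. beta_binomial \<alpha> \<beta> n j) - beta_cdf \<alpha> \<beta> (z / real n)\<bar> \<le> C1 / real n"
    using beta_binomial_cdf_left[OF pos] by blast
  obtain C2 where C2: "0 < C2" and right: "\<And>n k. 1 \<le> n \<Longrightarrow> 2 * k \<le> n \<Longrightarrow>
    \<exists>z. \<bar>z - real k\<bar> \<le> C2 \<and> \<bar>(\<Sum>j\<le>k. beta_binomial \<beta> \<alpha> n j) - beta_cdf \<beta> \<alpha> (z / real n)\<bar> \<le> C2 / real n"
    using beta_binomial_cdf_left[OF pos(2,1)] by blast
  define C where "C = C1 + C2 + 1"
  show ?thesis
  proof (rule exI[of _ C], intro conjI allI impI)
    show "0 < C" using C1 C2 by (simp add: C_def)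
    fix n k :: nat
    assume n: "1 \<le> n" "k < n"
    have CC: "C1 / n \<le> C / n" "C2 / n \<le> C / n" using C1 C2 by (auto simp: C_def divide_right_mono)
    show "\<exists>z. \<bar>z - real k\<bar> \<le> C \<and> \<bar>(\<Sum>j\<le>k. beta_binomial \<alpha> \<beta> n j) - beta_cdf \<alpha> \<beta> (z / real n)\<bar> \<le> C / real n"
    proof (cases "2 * k \<le> n")
      case True
      obtain z where "\<bar>z - real k\<bar> \<le> C1"
        "\<bar>(\<Sum>j\<le>k. beta_binomial \<alpha> \<beta> n j) - beta_cdf \<alpha> \<beta> (z / real n)\<bar> \<le> C1 / real n"
        using left[OF n(1) True] by blast
      then show ?thesis using CC C1 C2 by (intro exI[of _ z]) (auto simp: C_def)
    next
      case False
      \<comment> \<open>The tail j > k reflects to the indices up to n - k - 1, a genuine natural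
        number since k < n. The 1 subtracted here is the extra 1 in \<open>C\<close>.\<close>
      define k' where "k' = n - k - 1"
      have k': "2 * k' \<le> n" "real k' = real n - real k - 1" using False n by (auto simp: k'_def)
      obtain z where z: "\<bar>z - real k'\<bar> \<le> C2"
        "\<bar>(\<Sum>j\<le>k'. beta_binomial \<beta> \<alpha> n j) - beta_cdf \<beta> \<alpha> (z / real n)\<bar> \<le> C2 / real n"
        using right[OF n(1) k'(1)] by blast
      have "(\<Sum>j\<le>k'. beta_binomial \<beta> \<alpha> n j) = (\<Sum>j\<in>{k<..n}. beta_binomial \<alpha> \<beta> n j)"
        using n by (intro sum.reindex_bij_witness[of _ "\<lambda>j. n - j" "\<lambda>j. n - j"])
          (auto simp: k'_def beta_binomial_reflect[OF pos])
      moreover have "(\<Sum>j\<le>k. beta_binomial \<alpha> \<beta> n j) + (\<Sum>j\<in>{k<..n}. beta_binomial \<alpha> \<beta> n j) = 1"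
      proof -
        have "{..n} = {..k} \<union> {k<..n}" using n by auto
        then show ?thesis
          using sum_beta_binomial[OF pos, of n] by (simp add: sum.union_disjoint[symmetric] ivl_disj_int)
      qed
      moreover have "1 - z / real n = (real n - z) / real n" using n by (simp add: field_simps)
      ultimately have "\<bar>(\<Sum>j\<le>k. beta_binomial \<alpha> \<beta> n j) - beta_cdf \<alpha> \<beta> ((real n - z) / real n)\<bar> \<le> C2 / real n"
        using z(2) beta_cdf_reflect[OF pos, of "z / real n"] by (simp add: abs_le_iff)
      then show ?thesis using z(1) k'(2) CC C1 C2 by (intro exI[of _ "real n - z"]) (auto simp: C_def)
    qed
  qed
qed

text \<open>If colour \<open>i\<close> is drawn \<open>k\<close> times, then \<open>(k + \<gamma>) / (n + \<gamma> + \<delta>)\<close> is the value of \<open>Y\<^sub>n\<^sub>,\<^sub>i / n\<close> for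
  \<open>\<gamma> = \<delta> = 0\<close> and the value of \<open>X\<^sub>n\<^sub>,\<^sub>i / \<bar>X\<^sub>n\<bar>\<close> for \<open>\<gamma> = \<alpha>\<close>, \<open>\<delta> = \<beta>\<close>.\<close>
definition lattice_cdf :: "real \<Rightarrow> real \<Rightarrow> real \<Rightarrow> real \<Rightarrow> nat \<Rightarrow> real \<Rightarrow> real" where
  "lattice_cdf \<alpha> \<beta> \<gamma> \<delta> n x =
    (\<Sum>k | k \<le> n \<and> (real k + \<gamma>) / (real n + \<gamma> + \<delta>) \<le> x. beta_binomial \<alpha> \<beta> n k)"

text \<open>Solving the lattice inequality for k gives the threshold \<open>t\<close>. It differs
  from x * n by a bounded amount, which a horizontal shift of order 1 / n absorbs. Thresholds below
  0 or from n on make the sum 0 or 1 and are handled by the support of the beta law.\<close>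

lemma lattice_cdf_upper:
  assumes pos: "0 < \<alpha>" "0 < \<beta>" and shift: "0 \<le> \<gamma>" "0 \<le> \<delta>"
  shows "\<exists>C>0. \<forall>n\<ge>1. \<forall>x.
    beta_cdf \<alpha> \<beta> (x - C / real n) - C / real n \<le> lattice_cdf \<alpha> \<beta> \<gamma> \<delta> n x \<and>
    lattice_cdf \<alpha> \<beta> \<gamma> \<delta> n x \<le> beta_cdf \<alpha> \<beta> (x + C / real n) + C / real n"
proof -
  obtain C0 where C0: "0 < C0" and approx: "\<And>n k. 1 \<le> n \<Longrightarrow> k < n \<Longrightarrow>
    \<exists>z. \<bar>z - real k\<bar> \<le> C0 \<and> \<bar>(\<Sum>j\<le>k. beta_binomial \<alpha> \<beta> n j) - beta_cdf \<alpha> \<beta> (z / real n)\<bar> \<le> C0 / real n"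
    using beta_binomial_cdf_approx[OF pos] by blast
  \<comment> \<open>\<open>C0\<close> covers the distance from z to k, 1 the rounding of
    \<open>t\<close> down to k, and \<gamma> + \<delta> the change of scale from n + \<gamma> +
    \<delta> to n.\<close>
  define C where "C = C0 + 1 + \<gamma> + \<delta>"
  have C: "0 < C" using C0 shift by (simp add: C_def)
  show ?thesis
  proof (rule exI[of _ C], intro conjI allI impI C)
    fix n :: nat and x :: real
    assume n: "1 \<le> n"
    define D where "D = real n + \<gamma> + \<delta>"
    have D: "0 < D" "real n \<le> D" using n shift by (auto simp: D_def)
    define t where "t = x * D - \<gamma>"
    have le_iff: "(real k + \<gamma>) / D \<le> x \<longleftrightarrow> real k \<le> t" for k
      using D by (simp add: t_def field_simps)
    have H: "lattice_cdf \<alpha> \<beta> \<gamma> \<delta> n x = (\<Sum>k | k \<le> n \<and> real k \<le> t. beta_binomial \<alpha> \<beta> n k)"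
      by (simp add: lattice_cdf_def le_iff flip: D_def)
    have e: "0 \<le> C / real n" using C by simp
    have goal: "beta_cdf \<alpha> \<beta> (x - C / real n) - C / real n \<le> lattice_cdf \<alpha> \<beta> \<gamma> \<delta> n x \<and>
      lattice_cdf \<alpha> \<beta> \<gamma> \<delta> n x \<le> beta_cdf \<alpha> \<beta> (x + C / real n) + C / real n"
    proof -
      consider "t < 0" | "real n \<le> t" | "0 \<le> t" "t < real n" by linarith
      then show ?thesis
      proof cases
        case 1
        then have "{k. k \<le> n \<and> real k \<le> t} = {}" by auto
        then have "lattice_cdf \<alpha> \<beta> \<gamma> \<delta> n x = 0" unfolding H by (simp only: sum.empty)
        moreover have "x - C / real n \<le> 0"
        proof -
          have "x \<le> \<gamma> / D" using 1 D by (simp add: t_def field_simps)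
          also have "\<dots> \<le> C / real n" using C0 n shift D by (intro frac_le) (auto simp: C_def)
          finally show ?thesis by simp
        qed
        ultimately show ?thesis
          using e beta_cdf_nonneg[OF pos, of "x + C / n"] by (simp add: beta_cdf_le_0[OF pos])
      next
        case 2
        then have "{k. k \<le> n \<and> real k \<le> t} = {..n}" by auto
        then have "lattice_cdf \<alpha> \<beta> \<gamma> \<delta> n x = 1" by (simp add: H sum_beta_binomial[OF pos])
        moreover have "1 \<le> x + C / real n"
        proof -
          have "1 - x \<le> \<delta> / D" using 2 D by (simp add: t_def field_simps) (simp add: D_def)
          also have "\<dots> \<le> C / real n" using C0 n shift D by (intro frac_le) (auto simp: C_def)
          finally show ?thesis by simp
        qed
        ultimately show ?thesis
          using e beta_cdf_le_1[OF pos, of "x - C / n"] by (simp add: beta_cdf_ge_1[OF pos])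
      next
        case 3
        define k where "k = nat \<lfloor>t\<rfloor>"
        have k: "real k \<le> t" "t < real k + 1" "k < n"
          using 3 by (auto simp: k_def) linarith+
        then have "{k. k \<le> n \<and> real k \<le> t} = {..k}" by auto
        then have S: "lattice_cdf \<alpha> \<beta> \<gamma> \<delta> n x = (\<Sum>j\<le>k. beta_binomial \<alpha> \<beta> n j)" by (simp add: H)
        obtain z where z: "\<bar>z - real k\<bar> \<le> C0"
          "\<bar>(\<Sum>j\<le>k. beta_binomial \<alpha> \<beta> n j) - beta_cdf \<alpha> \<beta> (z / real n)\<bar> \<le> C0 / real n"
          using approx[OF n k(3)] by blast
        have x01: "0 \<le> x" "x \<le> 1"
        proof -
          have "0 \<le> x * D" using 3 shift by (simp add: t_def)
          then show "0 \<le> x" using D by (simp add: zero_le_mult_iff)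
          have "x * D \<le> 1 * D" using 3(2) shift t_def D_def by linarith
          then show "x \<le> 1" using D by (metis mult_right_le_imp_le)
        qed
        have xn: "x * real n = t + \<gamma> - x * (\<gamma> + \<delta>)" by (simp add: t_def D_def algebra_simps)
        have "x * (\<gamma> + \<delta>) \<le> \<gamma> + \<delta>" "0 \<le> x * (\<gamma> + \<delta>)"
          using x01 shift by (auto intro: mult_left_le_one_le)
        then have "x * real n \<le> z + C" "z - C \<le> x * real n"
          using xn k z(1) shift by (auto simp: C_def)
        then have "x \<le> (z + C) / real n" "(z - C) / real n \<le> x"
          using n by (auto simp: pos_le_divide_eq pos_divide_le_eq)
        then have "x - C / real n \<le> z / real n" "z / real n \<le> x + C / real n"
          by (auto simp: add_divide_distrib diff_divide_distrib)
        then have "beta_cdf \<alpha> \<beta> (x - C / real n) \<le> beta_cdf \<alpha> \<beta> (z / real n)"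
          "beta_cdf \<alpha> \<beta> (z / real n) \<le> beta_cdf \<alpha> \<beta> (x + C / real n)"
          by (auto intro: beta_cdf_mono[OF pos])
        moreover have "C0 / real n \<le> C / real n"
          using shift by (intro divide_right_mono) (auto simp: C_def)
        ultimately show ?thesis using z(2) S by (auto simp: abs_le_iff)
      qed
    qed
    from goal show "beta_cdf \<alpha> \<beta> (x - C / real n) - C / real n \<le> lattice_cdf \<alpha> \<beta> \<gamma> \<delta> n x" ..
    from goal show "lattice_cdf \<alpha> \<beta> \<gamma> \<delta> n x \<le> beta_cdf \<alpha> \<beta> (x + C / real n) + C / real n" ..
  qed
qed

text \<open>Two points at one and three quarters of a lattice gap stay in the gap when moved
  outwards by a small \<epsilon>, so the lattice function takes the same value at both. The beta
  function then grows by at most 2 * \<epsilon> between them, but its density forces growth of order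
  1 / n.\<close>

lemma lattice_cdf_lower:
  assumes pos: "0 < \<alpha>" "0 < \<beta>" and shift: "\<gamma> = 0 \<and> \<delta> = 0 \<or> 0 < \<gamma> \<and> 0 < \<delta>"
  shows "\<exists>c>0. \<forall>n\<ge>1. \<forall>\<epsilon>>0.
    (\<forall>x. lattice_cdf \<alpha> \<beta> \<gamma> \<delta> n (x - \<epsilon>) - \<epsilon> \<le> beta_cdf \<alpha> \<beta> x \<and>
      beta_cdf \<alpha> \<beta> x \<le> lattice_cdf \<alpha> \<beta> \<gamma> \<delta> n (x + \<epsilon>) + \<epsilon>) \<longrightarrow> c / real n \<le> \<epsilon>"
proof -
  have \<gamma>\<delta>: "0 \<le> \<gamma>" "0 \<le> \<delta>" using shift by auto
  \<comment> \<open>\<open>l\<close> keeps the two comparison points in [l, 1 - l] for every n at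
    once, which gives a density bound independent of n.\<close>
  obtain l where l: "0 < l" "l \<le> 1 / 8" "l * (\<gamma> + \<delta>) \<le> \<gamma>" "l * (\<gamma> + \<delta>) \<le> \<delta>"
  proof (cases "\<gamma> = 0")
    case True
    then show ?thesis using shift that[of "1 / 8"] by auto
  next
    case False
    then have gd: "0 < \<gamma>" "0 < \<delta>" using shift by auto
    define l where "l = min (1 / 8) (min \<gamma> \<delta> / (\<gamma> + \<delta>))"
    have "l * (\<gamma> + \<delta>) \<le> min \<gamma> \<delta> / (\<gamma> + \<delta>) * (\<gamma> + \<delta>)"
      using gd by (intro mult_right_mono) (auto simp: l_def)
    then have "l * (\<gamma> + \<delta>) \<le> min \<gamma> \<delta>" using gd by simp
    moreover have "0 < l" using gd by (simp add: l_def)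
    moreover have "l \<le> 1 / 8" unfolding l_def by (rule min.cobounded1)
    ultimately show ?thesis by (intro that[of l]) auto
  qed
  define m where "m = l powr \<bar>\<alpha> - 1\<bar> * (1 - (1 - l)) powr \<bar>\<beta> - 1\<bar> / Beta \<alpha> \<beta>"
  have m: "0 < m" using l Beta_pos[OF pos] by (simp add: m_def)
  \<comment> \<open>The 1 in the minimum ensures that an \<epsilon> violating the bound moves points
    by less than a quarter of a gap; 1 + \<gamma> + \<delta> compares n + \<gamma> + \<delta> with
    n.\<close>
  define c where "c = min 1 m / (4 * (1 + \<gamma> + \<delta>))"
  have c: "0 < c" using m \<gamma>\<delta> by (simp add: c_def)
  show ?thesis
  proof (rule exI[of _ c], intro conjI allI impI c)
    fix n :: nat and \<epsilon> :: real
    assume n: "1 \<le> n" and \<epsilon>: "0 < \<epsilon>"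
      and H: "\<forall>x. lattice_cdf \<alpha> \<beta> \<gamma> \<delta> n (x - \<epsilon>) - \<epsilon> \<le> beta_cdf \<alpha> \<beta> x \<and>
        beta_cdf \<alpha> \<beta> x \<le> lattice_cdf \<alpha> \<beta> \<gamma> \<delta> n (x + \<epsilon>) + \<epsilon>"
    define D where "D = real n + \<gamma> + \<delta>"
    have D: "0 < D" using n \<gamma>\<delta> by (auto simp: D_def)
    have Dn: "D \<le> real n * (1 + \<gamma> + \<delta>)"
      using n \<gamma>\<delta> mult_right_mono[of 1 "real n" "\<gamma> + \<delta>"] by (simp add: D_def algebra_simps)
    \<comment> \<open>The middle gap is used. The resulting bound k + 3 / 4 \<le> 7 * n / 8 is an
      equality at n = 2, which accounts for the 1 / 8 above.\<close>
    define k where "k = n div 2"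
    have "n = 1 \<and> k = 0 \<or> 2 \<le> n \<and> 2 * k \<le> n \<and> n \<le> 2 * k + 1"
      using n unfolding k_def by linarith
    then have k: "real n / 4 \<le> real k + 1 / 4" "real k + 3 / 4 \<le> real n - real n / 8"
      by auto
    define x1 where "x1 = (real k + 1 / 4 + \<gamma>) / D"
    define x2 where "x2 = (real k + 3 / 4 + \<gamma>) / D"
    have ln: "l * real n \<le> 1 / 8 * real n" using l by (intro mult_right_mono) auto
    have "l * D \<le> real k + 1 / 4 + \<gamma>"
      using k(1) l(3) ln by (simp add: D_def algebra_simps)
    then have lx: "l \<le> x1" using D by (simp add: x1_def pos_le_divide_eq)
    have "real k + 3 / 4 + \<gamma> \<le> (1 - l) * D"
    proof -
      have "(1 - l) * D = real n + \<gamma> + \<delta> - l * real n - l * (\<gamma> + \<delta>)"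
        by (simp add: D_def algebra_simps)
      then show ?thesis using k(2) l(4) ln by linarith
    qed
    then have xr: "x2 \<le> 1 - l" using D by (simp add: x2_def pos_divide_le_eq)
    have x12: "x2 - x1 = 1 / (2 * D)" "x1 \<le> x2"
      using D by (simp_all add: x1_def x2_def field_simps)
    have "min 1 m / (4 * D) \<le> \<epsilon>"
    proof (rule ccontr)
      assume "\<not> ?thesis"
      then have small: "\<epsilon> < min 1 m / (4 * D)" by simp
      also have "\<dots> \<le> 1 / (4 * D)" using D by (intro divide_right_mono) auto
      finally have e4: "\<epsilon> * D < 1 / 4" using D by (simp add: field_simps)
      have const: "lattice_cdf \<alpha> \<beta> \<gamma> \<delta> n y = lattice_cdf \<alpha> \<beta> \<gamma> \<delta> n x1"
        if y: "real k \<le> y * D - \<gamma>" "y * D - \<gamma> < real k + 1" for y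
      proof -
        have le_iff: "(real j + \<gamma>) / D \<le> y \<longleftrightarrow> real j \<le> y * D - \<gamma>" for j y
          using D by (simp add: field_simps)
        have "real j \<le> t \<longleftrightarrow> j \<le> k" if "real k \<le> t" "t < real k + 1" for j t
          using that by linarith
        from this[OF y] this[of "x1 * D - \<gamma>"]
        have "real j \<le> y * D - \<gamma> \<longleftrightarrow> real j \<le> x1 * D - \<gamma>" for j
          using D by (simp add: x1_def)
        then show ?thesis
          unfolding lattice_cdf_def D_def[symmetric] le_iff by simp
      qed
      have xD: "x1 * D = real k + 1 / 4 + \<gamma>" "x2 * D = real k + 3 / 4 + \<gamma>"
        using D by (simp_all add: x1_def x2_def)
      have eD: "0 < \<epsilon> * D" using \<epsilon> D by simp
      have "lattice_cdf \<alpha> \<beta> \<gamma> \<delta> n (x1 - \<epsilon>) = lattice_cdf \<alpha> \<beta> \<gamma> \<delta> n x1"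
        using e4 eD by (intro const) (auto simp: left_diff_distrib xD)
      moreover have "lattice_cdf \<alpha> \<beta> \<gamma> \<delta> n (x2 + \<epsilon>) = lattice_cdf \<alpha> \<beta> \<gamma> \<delta> n x1"
        using e4 eD by (intro const) (auto simp: distrib_right xD)
      ultimately have "beta_cdf \<alpha> \<beta> x2 - beta_cdf \<alpha> \<beta> x1 \<le> 2 * \<epsilon>"
        using H[rule_format, of x1] H[rule_format, of x2] by auto
      moreover have "m * (x2 - x1) \<le> beta_cdf \<alpha> \<beta> x2 - beta_cdf \<alpha> \<beta> x1"
        unfolding m_def using l lx xr x12 by (intro beta_cdf_lower_Lipschitz[OF pos]) auto
      ultimately have "m * (x2 - x1) \<le> 2 * \<epsilon>" by linarith
      then have "m / (4 * D) \<le> \<epsilon>" unfolding x12(1) using D by (simp add: field_simps)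
      moreover have "min 1 m / (4 * D) \<le> m / (4 * D)" using D by (intro divide_right_mono) auto
      ultimately show False using small by simp
    qed
    moreover have "c / real n \<le> min 1 m / (4 * D)"
    proof -
      have "c / real n = min 1 m / (4 * (real n * (1 + \<gamma> + \<delta>)))" by (simp add: c_def mult_ac)
      also have "\<dots> \<le> min 1 m / (4 * D)" using Dn D m by (intro divide_left_mono) auto
      finally show ?thesis .
    qed
    ultimately show "c / real n \<le> \<epsilon>" by simp
  qed
qed

section \<open>The law of the urn\<close>

text \<open>Pascal's rule splits according to the last draw: either it has the counted colour, after
  k - 1 such draws, or it has another one, after k.\<close>

lemma beta_binomial_Suc:
  "beta_binomial \<alpha> \<beta> (Suc n) k =
    (case k of 0 \<Rightarrow> 0 | Suc k' \<Rightarrow> beta_binomial \<alpha> \<beta> n k' * ((\<alpha> + k') / (\<alpha> + \<beta> + n)))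
    + beta_binomial \<alpha> \<beta> n k * ((\<beta> + n - k) / (\<alpha> + \<beta> + n))"
proof (cases k)
  case 0
  then show ?thesis by (simp add: beta_binomial_def pochhammer_Suc)
next
  case (Suc k')
  have 1: "real (n choose k') * pochhammer \<alpha> (Suc k') * pochhammer \<beta> (n - k') / pochhammer (\<alpha> + \<beta>) (Suc n)
    = beta_binomial \<alpha> \<beta> n k' * ((\<alpha> + k') / (\<alpha> + \<beta> + n))"
    by (simp add: beta_binomial_def pochhammer_Suc)
  have 2: "real (n choose Suc k') * pochhammer \<alpha> (Suc k') * pochhammer \<beta> (n - k') / pochhammer (\<alpha> + \<beta>) (Suc n)
    = beta_binomial \<alpha> \<beta> n (Suc k') * ((\<beta> + n - Suc k') / (\<alpha> + \<beta> + n))"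
  \<comment> \<open>For k' \<ge> n natural subtraction truncates, but the binomial coefficient makes
    both sides 0.\<close>
  proof (cases "k' < n")
    case True
    then have "n - k' = Suc (n - Suc k')" "real (n - Suc k') = real n - real (Suc k')" by auto
    then have "pochhammer \<beta> (n - k') = pochhammer \<beta> (n - Suc k') * (\<beta> + n - Suc k')"
      by (simp add: pochhammer_Suc add_diff_eq)
    then show ?thesis
      by (simp add: beta_binomial_def pochhammer_Suc)
  qed (simp add: beta_binomial_def binomial_eq_0)
  have "beta_binomial \<alpha> \<beta> (Suc n) k
      = (real (n choose k') + real (n choose Suc k')) * pochhammer \<alpha> (Suc k') * pochhammer \<beta> (n - k')
        / pochhammer (\<alpha> + \<beta>) (Suc n)"
    by (simp add: beta_binomial_def Suc)
  also have "\<dots> = beta_binomial \<alpha> \<beta> n k' * ((\<alpha> + k') / (\<alpha> + \<beta> + n))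
      + beta_binomial \<alpha> \<beta> n (Suc k') * ((\<beta> + n - Suc k') / (\<alpha> + \<beta> + n))"
    unfolding 1[symmetric] 2[symmetric] by (simp only: distrib_right add_divide_distrib)
  finally show ?thesis by (simp add: Suc)
qed

text \<open>The recursion in dual form: an expectation after n + 1 draws is the expectation after n
  draws of a one-step average. Induction along the urn needs it in this form.\<close>

lemma sum_beta_binomial_Suc:
  "(\<Sum>k\<le>Suc n. beta_binomial \<alpha> \<beta> (Suc n) k * f k) =
    (\<Sum>k\<le>n. beta_binomial \<alpha> \<beta> n k *
      ((\<alpha> + k) / (\<alpha> + \<beta> + n) * f (Suc k) + (\<beta> + n - k) / (\<alpha> + \<beta> + n) * f k))"
proof -
  have "(\<Sum>k\<le>Suc n. beta_binomial \<alpha> \<beta> (Suc n) k * f k) =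
      (\<Sum>k\<le>Suc n. (case k of 0 \<Rightarrow> 0 | Suc k' \<Rightarrow>
        beta_binomial \<alpha> \<beta> n k' * ((\<alpha> + k') / (\<alpha> + \<beta> + n))) * f k)
      + (\<Sum>k\<le>Suc n. beta_binomial \<alpha> \<beta> n k * ((\<beta> + n - k) / (\<alpha> + \<beta> + n)) * f k)"
    unfolding sum.distrib[symmetric]
    by (intro sum.cong refl) (simp only: beta_binomial_Suc atMost_iff distrib_right)
  also have "(\<Sum>k\<le>Suc n. (case k of 0 \<Rightarrow> 0 | Suc k' \<Rightarrow>
        beta_binomial \<alpha> \<beta> n k' * ((\<alpha> + k') / (\<alpha> + \<beta> + n))) * f k)
      = (\<Sum>k\<le>n. beta_binomial \<alpha> \<beta> n k * ((\<alpha> + k) / (\<alpha> + \<beta> + n)) * f (Suc k))"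
    by (subst sum.atMost_Suc_shift) simp
  also have "(\<Sum>k\<le>Suc n. beta_binomial \<alpha> \<beta> n k * ((\<beta> + n - k) / (\<alpha> + \<beta> + n)) * f k)
      = (\<Sum>k\<le>n. beta_binomial \<alpha> \<beta> n k * ((\<beta> + n - k) / (\<alpha> + \<beta> + n)) * f k)"
    by (simp add: beta_binomial_def[of _ _ n "Suc n"])
  finally show ?thesis
    by (simp only: distrib_left mult.assoc sum.distrib)
qed

lemma sum_lists_Suc:
  fixes f :: "'a::finite list \<Rightarrow> real"
  shows "(\<Sum>c | length c = Suc n. f c) = (\<Sum>c | length c = n. \<Sum>j\<in>UNIV. f (c @ [j]))"
proof -
  have "bij_betw (\<lambda>(c, j). c @ [j]) ({c. length c = n} \<times> (UNIV :: 'a set)) {c. length c = Suc n}"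
    by (intro bij_betwI[of _ _ _ "\<lambda>c. (butlast c, last c)"]) (auto simp: snoc_eq_iff_butlast)
  from sum.reindex_bij_betw[OF this, of f] show ?thesis
    by (simp add: sum.cartesian_product case_prod_unfold)
qed

section \<open>Urn histories as colour sequences\<close>

context polya_urn
begin

text \<open>Encoding histories by colour lists leaves finitely many of each length, so laws of the
  urn become finite sums.\<close>

definition path_state :: "'q list \<Rightarrow> real ^ 'q" where
  "path_state c = x0 + (\<Sum>j\<leftarrow>c. a *\<^sub>R axis j 1)"

definition follows :: "'q list \<Rightarrow> 'w set" where
  "follows c = {\<omega> \<in> space M. \<forall>k\<le>length c. X k \<omega> = path_state (take k c)}"

lemma path_state_nth: "path_state c $ i = x0 $ i + a * count_list c i"
  by (induction c) (auto simp: path_state_def axis_def algebra_simps)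

lemma path_state_snoc: "path_state (c @ [j]) = path_state c + a *\<^sub>R axis j 1"
  by (simp add: path_state_def add.assoc)

lemma sum_path_state: "(\<Sum>i\<in>UNIV. path_state c $ i) = (\<Sum>i\<in>UNIV. x0 $ i) + a * length c"
proof -
  have "(\<Sum>i\<in>UNIV. real (count_list c i)) = length c"
    using sum_count_set[of c UNIV] by (simp flip: of_nat_sum)
  then show ?thesis
    by (simp add: path_state_nth sum.distrib flip: sum_distrib_left)
qed

lemma x0_pos: "0 < x0 $ i"
proof -
  obtain \<omega> where "\<omega> \<in> space M" using not_empty by blast
  then show ?thesis using state_pos[of \<omega> 0 i] initial[of \<omega>] by simp
qed

lemma follows_measurable [measurable]: "follows c \<in> sets M"
proof -
  note measurable_state[measurable]
  show ?thesis unfolding follows_def by measurable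
qed

lemma follows_snoc:
  "follows (c @ [j]) = {\<omega> \<in> space M. X (Suc (length c)) \<omega> = X (length c) \<omega> + a *\<^sub>R axis j 1
    \<and> (\<forall>k\<le>length c. X k \<omega> = path_state (take k c))}"
  by (auto simp: follows_def le_Suc_eq path_state_snoc)

lemma follows_step:
  assumes "\<omega> \<in> follows c" "k < length c"
  shows "X (Suc k) \<omega> = X k \<omega> + a *\<^sub>R axis (c ! k) 1"
proof -
  have "X (Suc k) \<omega> = path_state (take (Suc k) c)" "X k \<omega> = path_state (take k c)"
    using assms by (auto simp: follows_def)
  then show ?thesis
    using assms(2) by (simp add: take_Suc_conv_app_nth path_state_snoc)
qed

context
  assumes a_pos: "0 < a"
begin

lemma l1_norm_x0: "l1_norm x0 = (\<Sum>i\<in>UNIV. x0 $ i)"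
  using x0_pos by (simp add: l1_norm_def less_imp_le)

lemma l1_norm_path_state: "l1_norm (path_state c) = l1_norm x0 + a * length c"
proof -
  have "0 \<le> path_state c $ i" for i
    using x0_pos[of i] a_pos by (simp add: path_state_nth)
  then have "l1_norm (path_state c) = (\<Sum>i\<in>UNIV. path_state c $ i)"
    by (simp add: l1_norm_def)
  then show ?thesis by (simp only: sum_path_state l1_norm_x0)
qed

text \<open>This is the transition law multiplied out. A null history has no conditional law, but
  then its extension is null as well.\<close>

lemma prob_follows_snoc:
  "prob (follows (c @ [j])) = prob (follows c) * (path_state c $ j / l1_norm (path_state c))"
proof (cases "prob (follows c) = 0")
  case True
  have "follows (c @ [j]) \<subseteq> follows c"
    by (auto simp: follows_snoc) (auto simp: follows_def)
  then have "prob (follows (c @ [j])) \<le> prob (follows c)"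
    by (intro finite_measure_mono) auto
  then show ?thesis using True measure_nonneg[of M] by (simp add: antisym)
next
  case False
  let ?s = "\<lambda>k. path_state (take k c)"
  have *: "prob (follows c) = \<P>(\<omega> in M. \<forall>k\<le>length c. X k \<omega> = ?s k)"
    by (simp add: follows_def)
  then have "0 < \<P>(\<omega> in M. \<forall>k\<le>length c. X k \<omega> = ?s k)"
    using False by (simp add: zero_less_measure_iff)
  from transition[OF this, of j] show ?thesis
    using False by (simp add: cond_prob_def follows_snoc * field_simps)
qed

text \<open>As a is nonzero, the increment of each step determines the colour drawn.\<close>

lemma follows_disjoint:
  assumes "length c = length c'" "c \<noteq> c'"
  shows "follows c \<inter> follows c' = {}"
proof (rule ccontr)
  assume "follows c \<inter> follows c' \<noteq> {}"
  then obtain \<omega> where \<omega>: "\<omega> \<in> follows c" "\<omega> \<in> follows c'" by auto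
  have "c ! k = c' ! k" if "k < length c" for k
    using follows_step[OF \<omega>(1), of k] follows_step[OF \<omega>(2), of k] that assms(1) a_pos
    by (simp add: axis_eq_axis)
  then show False using assms by (metis nth_equalityI)
qed

lemma draws_follows:
  assumes "\<omega> \<in> follows c"
  shows "draws a X (length c) i \<omega> = count_list c i"
proof -
  have "{k. k < length c \<and> X (Suc k) \<omega> = X k \<omega> + a *\<^sub>R axis i 1} = {k. k < length c \<and> i = c ! k}"
    using follows_step[OF assms] a_pos by (auto simp: axis_eq_axis)
  then show ?thesis
    by (simp add: draws_def count_list_eq_length_filter length_filter_conv_card)
qed

text \<open>The chance of drawing colour i depends only on how often it was drawn before, so the
  other colours can be merged. The test function is arbitrary because the induction step replaces it
  by its one-step average.\<close>

lemma sum_prob_follows: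
  fixes f :: "nat \<Rightarrow> real" and i :: 'q
  defines "\<alpha> \<equiv> x0 $ i / a" and "\<beta> \<equiv> (l1_norm x0 - x0 $ i) / a"
  shows "(\<Sum>c | length c = n. prob (follows c) * f (count_list c i))
    = (\<Sum>k\<le>n. beta_binomial \<alpha> \<beta> n k * f k)"
proof (induction n arbitrary: f)
  case 0
  have "follows [] = space M"
    using initial by (auto simp: follows_def path_state_def)
  then show ?case by (simp add: beta_binomial_def prob_space)
next
  case (Suc n)
  define g where "g k = (\<alpha> + k) / (\<alpha> + \<beta> + n) * f (Suc k) + (\<beta> + n - k) / (\<alpha> + \<beta> + n) * f k" for k
  have step: "(\<Sum>j\<in>UNIV. path_state c $ j / l1_norm (path_state c) * f (count_list (c @ [j]) i))
    = g (count_list c i)" if "length c = n" for c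
  proof -
    define m where "m = count_list c i"
    define L where "L = l1_norm (path_state c)"
    have "a * (\<alpha> + \<beta>) = l1_norm x0"
      using a_pos by (simp add: \<alpha>_def \<beta>_def flip: add_divide_distrib)
    then have L: "L = a * (\<alpha> + \<beta> + n)"
      using that by (simp add: L_def l1_norm_path_state distrib_left)
    have pi: "path_state c $ i = a * (\<alpha> + m)"
      using a_pos by (simp add: path_state_nth \<alpha>_def m_def distrib_left)
    have total: "(\<Sum>j\<in>UNIV. path_state c $ j) = L"
      by (simp add: L_def sum_path_state l1_norm_path_state l1_norm_x0)
    \<comment> \<open>All colours other than i leave the count unchanged, so only their total mass L
      minus that of i matters.\<close>
    have "(\<Sum>j\<in>UNIV. path_state c $ j / L * f (count_list (c @ [j]) i))
      = path_state c $ i / L * f (Suc m) + (\<Sum>j\<in>UNIV - {i}. path_state c $ j / L * f m)"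
      by (subst sum.remove[of _ i]) (auto simp: m_def)
    also have "(\<Sum>j\<in>UNIV - {i}. path_state c $ j / L * f m) = (L - path_state c $ i) / L * f m"
      using total by (simp add: sum_diff1 flip: sum_distrib_right sum_divide_distrib)
    also have "path_state c $ i / L = (\<alpha> + m) / (\<alpha> + \<beta> + n)"
      using a_pos by (simp add: pi L)
    also have "(L - path_state c $ i) / L = (\<beta> + n - m) / (\<alpha> + \<beta> + n)"
    proof -
      have "L - path_state c $ i = a * (\<beta> + n - m)" by (simp add: pi L algebra_simps)
      then show ?thesis using a_pos by (simp add: L)
    qed
    finally show ?thesis by (simp add: g_def m_def L_def)
  qed
  have "(\<Sum>c | length c = Suc n. prob (follows c) * f (count_list c i))
    = (\<Sum>c | length c = n. prob (follows c) *
        (\<Sum>j\<in>UNIV. path_state c $ j / l1_norm (path_state c) * f (count_list (c @ [j]) i)))"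
    unfolding sum_lists_Suc prob_follows_snoc by (simp only: sum_distrib_left mult.assoc)
  also have "\<dots> = (\<Sum>c | length c = n. prob (follows c) * g (count_list c i))"
    by (rule sum.cong) (simp_all only: step mem_Collect_eq)
  also have "\<dots> = (\<Sum>k\<le>n. beta_binomial \<alpha> \<beta> n k * g k)" by (rule Suc)
  finally show ?case
    unfolding g_def sum_beta_binomial_Suc .
qed

text \<open>The histories of length n exhaust the space almost surely, so the law of Z is determined
  by its values on them. One statement serves both urn variables.\<close>

lemma cdf_eq_lattice_cdf:
  assumes i: "x0 $ i < l1_norm x0"
  defines "\<alpha> \<equiv> x0 $ i / a" and "\<beta> \<equiv> (l1_norm x0 - x0 $ i) / a"
  assumes Z: "Z \<in> borel_measurable M"
    and Z_follows: "\<And>c \<omega>. length c = n \<Longrightarrow> \<omega> \<in> follows c \<Longrightarrow>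
      Z \<omega> = (real (count_list c i) + \<gamma>) / (real n + \<gamma> + \<delta>)"
  shows "cdf (distr M borel Z) = lattice_cdf \<alpha> \<beta> \<gamma> \<delta> n"
proof
  fix x
  have pos: "0 < \<alpha>" "0 < \<beta>" using i x0_pos a_pos by (auto simp: \<alpha>_def \<beta>_def)
  let ?h = "\<lambda>k. (real k + \<gamma>) / (real n + \<gamma> + \<delta>)"
  let ?U = "\<Union>c\<in>{c. length c = n}. follows c"
  have fin: "finite {c :: 'q list. length c = n}"
    using finite_lists_length_eq[of "UNIV :: 'q set" n] by simp
  have union: "prob (\<Union>c\<in>{c. length c = n \<and> Q c}. follows c)
      = (\<Sum>c | length c = n. prob (follows c) * of_bool (Q c))" for Q
  proof -
    have "prob (\<Union>c\<in>{c. length c = n \<and> Q c}. follows c) = (\<Sum>c | length c = n \<and> Q c. prob (follows c))"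
      using fin by (intro finite_measure_finite_Union)
        (auto simp: disjoint_family_on_def follows_disjoint)
    also have "\<dots> = (\<Sum>c | length c = n. prob (follows c) * of_bool (Q c))"
      using fin by (intro sum.mono_neutral_cong_left) auto
    finally show ?thesis .
  qed
  \<comment> \<open>Taking the constant test function 1 turns the total probability of the histories
    into the total beta-binomial mass.\<close>
  have "prob ?U = 1"
    using union[of "\<lambda>_. True"] sum_prob_follows[where i = i and n = n and f = "\<lambda>_. 1"] sum_beta_binomial[OF pos, of n]
    by (simp add: \<alpha>_def \<beta>_def)
  then have AE_U: "AE \<omega> in M. \<omega> \<in> ?U" by (rule AE_prob_1)
  have "cdf (distr M borel Z) x = prob {\<omega> \<in> space M. Z \<omega> \<le> x}"
    using Z by (auto simp: cdf_def measure_distr intro!: arg_cong[where f = prob])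
  also have "\<dots> = prob (\<Union>c\<in>{c. length c = n \<and> ?h (count_list c i) \<le> x}. follows c)"
  proof (rule finite_measure_eq_AE)
    show "AE \<omega> in M. \<omega> \<in> {\<omega> \<in> space M. Z \<omega> \<le> x} \<longleftrightarrow>
        \<omega> \<in> (\<Union>c\<in>{c. length c = n \<and> ?h (count_list c i) \<le> x}. follows c)"
      using AE_U
    proof (eventually_elim)
      case (elim \<omega>)
      then obtain c where c: "length c = n" "\<omega> \<in> follows c" by auto
      have "\<omega> \<in> space M" using c by (simp add: follows_def)
      moreover have "\<omega> \<in> follows c' \<longleftrightarrow> c' = c" if "length c' = n" for c'
        using follows_disjoint[of c c'] c that by auto
      ultimately show ?case using c Z_follows[OF c] by auto
    qed
    show "{\<omega> \<in> space M. Z \<omega> \<le> x} \<in> events" using Z by measurable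
    show "(\<Union>c\<in>{c. length c = n \<and> ?h (count_list c i) \<le> x}. follows c) \<in> events"
      using fin by (intro sets.finite_UN) auto
  qed
  also have "\<dots> = (\<Sum>c | length c = n. prob (follows c) * of_bool (?h (count_list c i) \<le> x))"
    by (rule union)
  also have "\<dots> = (\<Sum>k\<le>n. beta_binomial \<alpha> \<beta> n k * of_bool (?h k \<le> x))"
    using sum_prob_follows[where i = i and n = n and f = "\<lambda>k. of_bool (?h k \<le> x)"] by (simp add: \<alpha>_def \<beta>_def)
  also have "\<dots> = lattice_cdf \<alpha> \<beta> \<gamma> \<delta> n x"
    unfolding lattice_cdf_def by (intro sum.mono_neutral_cong_right) auto
  finally show "cdf (distr M borel Z) x = lattice_cdf \<alpha> \<beta> \<gamma> \<delta> n x" .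
qed

lemma cdf_proportion:
  assumes i: "x0 $ i < l1_norm x0"
  defines "\<alpha> \<equiv> x0 $ i / a" and "\<beta> \<equiv> (l1_norm x0 - x0 $ i) / a"
  shows "cdf (distr M borel (\<lambda>\<omega>. X n \<omega> $ i / l1_norm (X n \<omega>))) = lattice_cdf \<alpha> \<beta> \<alpha> \<beta> n"
  unfolding \<alpha>_def \<beta>_def
proof (rule cdf_eq_lattice_cdf[OF i])
  note measurable_state[measurable]
  have "(\<lambda>x. x $ j) \<in> borel_measurable borel" for j :: 'q
    by (intro borel_measurable_continuous_onI continuous_intros)
  note this[measurable]
  show "(\<lambda>\<omega>. X n \<omega> $ i / l1_norm (X n \<omega>)) \<in> borel_measurable M"
    unfolding l1_norm_def by measurable
next
  fix c \<omega>
  assume c: "length c = n" "\<omega> \<in> follows c"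
  then have "X n \<omega> = path_state c" by (auto simp: follows_def)
  then have "X n \<omega> $ i / l1_norm (X n \<omega>) = (x0 $ i + a * count_list c i) / (l1_norm x0 + a * n)"
    by (simp add: path_state_nth l1_norm_path_state c)
  also have "\<dots> = (a * (count_list c i + x0 $ i / a)) / (a * (n + x0 $ i / a + (l1_norm x0 - x0 $ i) / a))"
    using a_pos by (intro arg_cong2[where f = "(/)"]) (simp_all add: distrib_left)
  also have "\<dots> = (count_list c i + x0 $ i / a) / (n + x0 $ i / a + (l1_norm x0 - x0 $ i) / a)"
    using a_pos by (intro mult_divide_mult_cancel_left) auto
  finally show "X n \<omega> $ i / l1_norm (X n \<omega>) = \<dots>" .
qed

lemma draws_measurable: "(\<lambda>\<omega>. real (draws a X n i \<omega>)) \<in> borel_measurable M"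
proof -
  note measurable_state[measurable]
  have "real (draws a X n i \<omega>) = (\<Sum>k<n. of_bool (X (Suc k) \<omega> = X k \<omega> + a *\<^sub>R axis i 1))" for \<omega>
    by (auto simp: draws_def sum_of_bool_eq Int_def intro!: arg_cong[where f = card])
  then show ?thesis by simp
qed

lemma cdf_draws:
  assumes i: "x0 $ i < l1_norm x0"
  shows "cdf (distr M borel (\<lambda>\<omega>. real (draws a X n i \<omega>) / real n))
    = lattice_cdf (x0 $ i / a) ((l1_norm x0 - x0 $ i) / a) 0 0 n"
proof (rule cdf_eq_lattice_cdf[OF i])
  show "(\<lambda>\<omega>. real (draws a X n i \<omega>) / real n) \<in> borel_measurable M"
    using draws_measurable by measurable
qed (auto simp: draws_follows)

end

end

section \<open>Bounds for the distance\<close>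

lemma divide_bounds_weaken:
  fixes c C d :: real
  assumes "c / real n \<le> d \<and> d \<le> C / real n" "c' \<le> c" "C \<le> C'"
  shows "c' / real n \<le> d \<and> d \<le> C' / real n"
  using assms divide_right_mono[of c' c "real n"] divide_right_mono[of C C' "real n"] by linarith

text \<open>The constants are chosen before the probability spaces because the distance depends only
  on the two distribution functions.\<close>

lemma levy_dist_lattice:
  assumes pos: "0 < \<alpha>" "0 < \<beta>" and shift: "\<gamma> = 0 \<and> \<delta> = 0 \<or> 0 < \<gamma> \<and> 0 < \<delta>"
  shows "\<exists>c C. 0 < c \<and> c \<le> C \<and>
    (\<forall>(M :: 'w measure) Z (N :: 'v measure) W n. 1 \<le> n \<longrightarrow>
      cdf (distr M borel Z) = lattice_cdf \<alpha> \<beta> \<gamma> \<delta> n \<longrightarrow>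
      cdf (distr N borel W) = beta_cdf \<alpha> \<beta> \<longrightarrow>
      c / real n \<le> levy_dist M Z N W \<and> levy_dist M Z N W \<le> C / real n)"
proof -
  obtain C where C: "0 < C" and upper: "\<And>n x. 1 \<le> n \<Longrightarrow>
      beta_cdf \<alpha> \<beta> (x - C / real n) - C / real n \<le> lattice_cdf \<alpha> \<beta> \<gamma> \<delta> n x \<and>
      lattice_cdf \<alpha> \<beta> \<gamma> \<delta> n x \<le> beta_cdf \<alpha> \<beta> (x + C / real n) + C / real n"
    using lattice_cdf_upper[OF pos, of \<gamma> \<delta>] shift by force
  obtain c where c: "0 < c" and lower: "\<And>n \<epsilon>. 1 \<le> n \<Longrightarrow> 0 < \<epsilon> \<Longrightarrow>
      (\<forall>x. lattice_cdf \<alpha> \<beta> \<gamma> \<delta> n (x - \<epsilon>) - \<epsilon> \<le> beta_cdf \<alpha> \<beta> x \<and>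
        beta_cdf \<alpha> \<beta> x \<le> lattice_cdf \<alpha> \<beta> \<gamma> \<delta> n (x + \<epsilon>) + \<epsilon>) \<Longrightarrow> c / real n \<le> \<epsilon>"
    using lattice_cdf_lower[OF pos shift] by blast
  have bounds: "c / real n \<le> levy_dist M Z N W \<and> levy_dist M Z N W \<le> C / real n"
    if n: "1 \<le> n" and Z: "cdf (distr M borel Z) = lattice_cdf \<alpha> \<beta> \<gamma> \<delta> n"
      and W: "cdf (distr N borel W) = beta_cdf \<alpha> \<beta>"
    for M :: "'w measure" and Z and N :: "'v measure" and W n
  proof -
    define E where "E = {\<epsilon>. 0 < \<epsilon> \<and>
      (\<forall>x. lattice_cdf \<alpha> \<beta> \<gamma> \<delta> n (x - \<epsilon>) - \<epsilon> \<le> beta_cdf \<alpha> \<beta> x \<and>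
        beta_cdf \<alpha> \<beta> x \<le> lattice_cdf \<alpha> \<beta> \<gamma> \<delta> n (x + \<epsilon>) + \<epsilon>)}"
    have levy: "levy_dist M Z N W = Inf E"
      by (simp add: levy_dist_def E_def Z W)
    have "C / real n \<in> E"
    proof -
      \<comment> \<open>The available bound shifts the beta function, whereas the distance shifts
        the lattice function; evaluating at x - C / n and x + C / n exchanges the roles.\<close>
      have "lattice_cdf \<alpha> \<beta> \<gamma> \<delta> n (x - C / real n) - C / real n \<le> beta_cdf \<alpha> \<beta> x" for x
        using upper[OF n, of "x - C / real n"] by simp
      moreover have "beta_cdf \<alpha> \<beta> x \<le> lattice_cdf \<alpha> \<beta> \<gamma> \<delta> n (x + C / real n) + C / real n" for x
        using upper[OF n, of "x + C / real n"] by simp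
      ultimately show ?thesis using C n by (simp add: E_def)
    qed
    moreover have low: "c / real n \<le> \<epsilon>" if "\<epsilon> \<in> E" for \<epsilon>
      using that lower[OF n] by (auto simp: E_def)
    moreover have "bdd_below E" using low by (rule bdd_belowI)
    ultimately show ?thesis
      unfolding levy by (blast intro: cInf_greatest cInf_lower)
  qed
  show ?thesis
  proof (rule exI[of _ c], rule exI[of _ "max c C"], intro conjI[OF c] conjI[OF max.cobounded1] allI impI)
    fix M :: "'w measure" and Z and N :: "'v measure" and W and n
    assume "1 \<le> n" "cdf (distr M borel Z) = lattice_cdf \<alpha> \<beta> \<gamma> \<delta> n"
      "cdf (distr N borel W) = beta_cdf \<alpha> \<beta>"
    from bounds[OF this] show "c / real n \<le> levy_dist M Z N W \<and> levy_dist M Z N W \<le> max c C / real n"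
      by (rule divide_bounds_weaken) auto
  qed
qed

lemma cdf_distributed_beta:
  assumes "distributed N lborel W (\<lambda>x. ennreal (beta_density \<alpha> \<beta> x))"
  shows "cdf (distr N borel W) = beta_cdf \<alpha> \<beta>"
proof -
  have "distr N borel W = distr N lborel W" by (rule distr_cong) auto
  also have "\<dots> = beta_distr \<alpha> \<beta>"
    using assms by (simp add: distributed_def beta_distr_def)
  finally show ?thesis by (simp add: beta_cdf_def)
qed

theorem theorem1p5:
  fixes a :: real and x0 :: "real ^ 'q"
  assumes "CARD('q) \<ge> 2" and "a > 0" and "\<And>i. x0 $ i > 0"
  shows "\<exists>c C :: real. 0 < c \<and> c \<le> C \<and>
    (\<forall>(M :: 'w measure) (X :: nat \<Rightarrow> 'w \<Rightarrow> real ^ 'q) (i :: 'q) (N :: 'v measure) (W :: 'v \<Rightarrow> real).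
      polya_urn M a x0 X \<longrightarrow>
      prob_space N \<longrightarrow>
      distributed N lborel W
        (\<lambda>x. ennreal (beta_density (x0 $ i / a) ((l1_norm x0 - x0 $ i) / a) x)) \<longrightarrow>
      (\<forall>n\<ge>1::nat.
        c / real n \<le> levy_dist M (\<lambda>\<omega>. X n \<omega> $ i / l1_norm (X n \<omega>)) N W \<and>
        levy_dist M (\<lambda>\<omega>. X n \<omega> $ i / l1_norm (X n \<omega>)) N W \<le> C / real n \<and>
        c / real n \<le> levy_dist M (\<lambda>\<omega>. real (draws a X n i \<omega>) / real n) N W \<and>
        levy_dist M (\<lambda>\<omega>. real (draws a X n i \<omega>) / real n) N W \<le> C / real n))"
proof -
  let ?\<alpha> = "\<lambda>i. x0 $ i / a" and ?\<beta> = "\<lambda>i. (l1_norm x0 - x0 $ i) / a"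
  \<comment> \<open>A second colour with positive initial mass makes the inequality strict, and
    hence the second beta parameter positive.\<close>
  have i_less: "x0 $ i < l1_norm x0" for i
  proof -
    have "UNIV \<noteq> {i}"
    proof
      assume "UNIV = {i}"
      then have "CARD('q) = card {i}" by (rule arg_cong)
      with assms(1) show False by simp
    qed
    then have "0 < (\<Sum>j\<in>UNIV - {i}. x0 $ j)" using assms(3) by (intro sum_pos) auto
    then show ?thesis using assms(3) by (simp add: l1_norm_def sum_diff1 less_imp_le)
  qed
  have pos: "0 < ?\<alpha> i" "0 < ?\<beta> i" for i
    using assms i_less[of i] by auto
  define P where "P i c C \<longleftrightarrow> 0 < c \<and> c \<le> C \<and> (\<forall>(M :: 'w measure) Z Y (N :: 'v measure) W n. 1 \<le> n \<longrightarrow>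
      cdf (distr M borel Z) = lattice_cdf (?\<alpha> i) (?\<beta> i) (?\<alpha> i) (?\<beta> i) n \<longrightarrow>
      cdf (distr M borel Y) = lattice_cdf (?\<alpha> i) (?\<beta> i) 0 0 n \<longrightarrow>
      cdf (distr N borel W) = beta_cdf (?\<alpha> i) (?\<beta> i) \<longrightarrow>
      c / real n \<le> levy_dist M Z N W \<and> levy_dist M Z N W \<le> C / real n \<and>
      c / real n \<le> levy_dist M Y N W \<and> levy_dist M Y N W \<le> C / real n)" for i c C
  have "\<exists>c C. P i c C" for i
  proof -
    obtain c1 C1 where 1: "0 < c1" "c1 \<le> C1" "\<And>(M :: 'w measure) Z (N :: 'v measure) W n. 1 \<le> n \<Longrightarrow>
      cdf (distr M borel Z) = lattice_cdf (?\<alpha> i) (?\<beta> i) (?\<alpha> i) (?\<beta> i) n \<Longrightarrow>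
      cdf (distr N borel W) = beta_cdf (?\<alpha> i) (?\<beta> i) \<Longrightarrow>
      c1 / real n \<le> levy_dist M Z N W \<and> levy_dist M Z N W \<le> C1 / real n"
      using levy_dist_lattice[OF pos[of i], of "?\<alpha> i" "?\<beta> i"] pos[of i] by blast
    obtain c2 C2 where 2: "0 < c2" "c2 \<le> C2" "\<And>(M :: 'w measure) Z (N :: 'v measure) W n. 1 \<le> n \<Longrightarrow>
      cdf (distr M borel Z) = lattice_cdf (?\<alpha> i) (?\<beta> i) 0 0 n \<Longrightarrow>
      cdf (distr N borel W) = beta_cdf (?\<alpha> i) (?\<beta> i) \<Longrightarrow>
      c2 / real n \<le> levy_dist M Z N W \<and> levy_dist M Z N W \<le> C2 / real n"
      using levy_dist_lattice[OF pos[of i], of 0 0] by blast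
    show ?thesis
      unfolding P_def
    proof (rule exI[of _ "min c1 c2"], rule exI[of _ "max C1 C2"], intro conjI[of "0 < _"] conjI[of "min _ _ \<le> _"] allI impI)
      show "0 < min c1 c2" "min c1 c2 \<le> max C1 C2" using 1 2 by auto
      fix M :: "'w measure" and Z Y and N :: "'v measure" and W and n
      assume n: "1 \<le> n"
        and Z: "cdf (distr M borel Z) = lattice_cdf (?\<alpha> i) (?\<beta> i) (?\<alpha> i) (?\<beta> i) n"
        and Y: "cdf (distr M borel Y) = lattice_cdf (?\<alpha> i) (?\<beta> i) 0 0 n"
        and W: "cdf (distr N borel W) = beta_cdf (?\<alpha> i) (?\<beta> i)"
      have "min c1 c2 / real n \<le> levy_dist M Z N W \<and> levy_dist M Z N W \<le> max C1 C2 / real n"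
        by (rule divide_bounds_weaken[OF 1(3)[OF n Z W]]) auto
      moreover have "min c1 c2 / real n \<le> levy_dist M Y N W \<and> levy_dist M Y N W \<le> max C1 C2 / real n"
        by (rule divide_bounds_weaken[OF 2(3)[OF n Y W]]) auto
      ultimately show "min c1 c2 / real n \<le> levy_dist M Z N W \<and> levy_dist M Z N W \<le> max C1 C2 / real n \<and>
        min c1 c2 / real n \<le> levy_dist M Y N W \<and> levy_dist M Y N W \<le> max C1 C2 / real n" by simp
    qed
  qed
  \<comment> \<open>The constants still depend on the colour; since there are finitely many colours,
    the minimum and the maximum over them serve all.\<close>
  then obtain c C where P: "\<And>i. P i (c i) (C i)" by metis
  have cC: "0 < c i" "c i \<le> C i" for i
    using P[of i] by (simp_all add: P_def)
  show ?thesis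
  proof (rule exI[of _ "Min (range c)"], rule exI[of _ "Max (range C)"], intro conjI)
    show "0 < Min (range c)" using cC by (subst Min_gr_iff) auto
    have "Min (range c) \<le> c i" "c i \<le> C i" "C i \<le> Max (range C)" for i
      using cC by auto
    then show "Min (range c) \<le> Max (range C)" by (meson order_trans)
    show "\<forall>(M :: 'w measure) (X :: nat \<Rightarrow> 'w \<Rightarrow> real ^ 'q) (i :: 'q) (N :: 'v measure) (W :: 'v \<Rightarrow> real).
      polya_urn M a x0 X \<longrightarrow>
      prob_space N \<longrightarrow>
      distributed N lborel W (\<lambda>x. ennreal (beta_density (?\<alpha> i) (?\<beta> i) x)) \<longrightarrow>
      (\<forall>n\<ge>1::nat.
        Min (range c) / real n \<le> levy_dist M (\<lambda>\<omega>. X n \<omega> $ i / l1_norm (X n \<omega>)) N W \<and>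
        levy_dist M (\<lambda>\<omega>. X n \<omega> $ i / l1_norm (X n \<omega>)) N W \<le> Max (range C) / real n \<and>
        Min (range c) / real n \<le> levy_dist M (\<lambda>\<omega>. real (draws a X n i \<omega>) / real n) N W \<and>
        levy_dist M (\<lambda>\<omega>. real (draws a X n i \<omega>) / real n) N W \<le> Max (range C) / real n)"
    proof (intro allI impI)
      fix M :: "'w measure" and X :: "nat \<Rightarrow> 'w \<Rightarrow> real ^ 'q" and i :: 'q
        and N :: "'v measure" and W :: "'v \<Rightarrow> real" and n :: nat
      assume urn: "polya_urn M a x0 X" and n: "1 \<le> n"
        and W: "distributed N lborel W (\<lambda>x. ennreal (beta_density (?\<alpha> i) (?\<beta> i) x))"
      note b = P[of i, unfolded P_def, THEN conjunct2, THEN conjunct2, rule_format, OF n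
          polya_urn.cdf_proportion[OF urn assms(2) i_less]
          polya_urn.cdf_draws[OF urn assms(2) i_less] cdf_distributed_beta[OF W]]
      have cC': "Min (range c) \<le> c i" "C i \<le> Max (range C)" by auto
      show "Min (range c) / real n \<le> levy_dist M (\<lambda>\<omega>. X n \<omega> $ i / l1_norm (X n \<omega>)) N W \<and>
        levy_dist M (\<lambda>\<omega>. X n \<omega> $ i / l1_norm (X n \<omega>)) N W \<le> Max (range C) / real n \<and>
        Min (range c) / real n \<le> levy_dist M (\<lambda>\<omega>. real (draws a X n i \<omega>) / real n) N W \<and>
        levy_dist M (\<lambda>\<omega>. real (draws a X n i \<omega>) / real n) N W \<le> Max (range C) / real n"
      proof -
        have "Min (range c) / real n \<le> levy_dist M (\<lambda>\<omega>. X n \<omega> $ i / l1_norm (X n \<omega>)) N W \<and>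
          levy_dist M (\<lambda>\<omega>. X n \<omega> $ i / l1_norm (X n \<omega>)) N W \<le> Max (range C) / real n"
          by (rule divide_bounds_weaken[OF _ cC'], rule conjI[OF b[THEN conjunct1] b[THEN conjunct2, THEN conjunct1]])
        moreover have "Min (range c) / real n \<le> levy_dist M (\<lambda>\<omega>. real (draws a X n i \<omega>) / real n) N W \<and>
          levy_dist M (\<lambda>\<omega>. real (draws a X n i \<omega>) / real n) N W \<le> Max (range C) / real n"
          by (rule divide_bounds_weaken[OF _ cC'], rule b[THEN conjunct2, THEN conjunct2])
        ultimately show ?thesis by (simp only: simp_thms)
      qed
    qed
  qed
qed

end
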